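(* Let $\mathbb{X}\subseteq\mathbb{R}^n$ be open, let $\bar x\in\mathbb{X}$, and let $\omega$ be a size function for $(\mathbb{X},\bar x)$. Let $\eta>0$ be a constant and let $B:\mathbb{X}\to\mathbb{R}^{n\times m}$ be locally Lipschitz and bounded. If $V:\mathbb{X}\to\mathbb{R}$ is a proper loss function, then the system $$\dot x(t)=-\eta\,\nabla V(x(t))^T+B(x(t))u(t)$$ is input to state stable (ISS) on $\mathbb{X}$ with respect to $\bar x$.
   Context: Notation: $|\cdot|$ is the Euclidean norm; $\nabla V$ is the gradient written as a row vector, $T$ denotes transpose. $\mathcal{K}$ is the set of continuous, strictly increasing $\alpha:[0,\infty)\to[0,\infty)$ with $\alpha(0)=0$; $\mathcal{K}_\infty$ is the set of unbounded elements of $\mathcal{K}$. A function $\beta:[0,\infty)\times[0,\infty)\to[0,\infty)$ is of class $\mathcal{KL}$ if $\beta(\cdot,t)\in\mathcal{K}$ for each fixed $t$, and for each fixed $r$, $\beta(r,t)$ decreases (is nonincreasing in $t$) to $0$ as $t\to\infty$. Size function: $\omega:\mathbb{X}\to\mathbb{R}$ is a size function for $(\mathbb{X},\bar x)$ if it is continuous, positive definite with respect to $\bar x$ ($\omega(\bar x)=0$ and $\omega(x)>0$ for $x\in\mathbb{X}$, $x\ne\bar x$), and proper (for every real $r\ge0$ the sublevel set $\{x\in\mathbb{X}: \omega(x)\le r\}$ is a compact subset of $\mathbb{X}$). Proper loss function: a continuously differentiable $V:\mathbb{X}\to\mathbb{R}$ with locally Lipschitz gradient $\nabla V$ such that both $V-V(\bar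 x)$ and $x\mapsto|\nabla V(x)|$ are size functions for $(\mathbb{X},\bar x)$. Inputs are Lebesgue measurable essentially bounded maps $u:[0,\infty)\to\mathbb{R}^m$, with $\|u\|_\infty=\operatorname{ess\,sup}_{t\ge0}|u(t)|$. For $x^0\in\mathbb{X}$ and an input $u$, $x(t,x^0,u)\in\mathbb{X}$ denotes the (absolutely continuous) solution of the system with $x(0)=x^0$, on its maximal interval $[0,t_{\max}(x^0,u))$. ISS: a system $\dot x=f(x,u)$ (with $f:\mathbb{X}\times\mathbb{R}^m\to\mathbb{R}^n$ locally Lipschitz, $f(\bar x,0)=0$) is ISS on $\mathbb{X}$ with respect to $\bar x$ if there exist $\beta\in\mathcal{KL}$ and $\gamma\in\mathcal{K}_\infty$ such that for all inputs $u$ and all $x^0\in\mathbb{X}$ one has $t_{\max}(x^0,u)=+\infty$ and $\omega(x(t,x^0,u))\le\beta(\omega(x^0),t)+\gamma(\|u\|_\infty)$ for all $t\ge0$. *)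

theory Defs
  imports "HOL-Analysis.Analysis" "HOL-Probability.Essential_Supremum"
begin

section \<open>Regularity\<close>

text \<open>The library notion is for functions with an additional time parameter; here that parameter
  is a dummy.\<close>

definition locally_lipschitz_on :: "'a::metric_space set \<Rightarrow> ('a \<Rightarrow> 'b::metric_space) \<Rightarrow> bool"
  where "locally_lipschitz_on S f \<longleftrightarrow> local_lipschitz (UNIV :: real set) S (\<lambda>_. f)"

definition gradient :: "('a::real_inner \<Rightarrow> real) \<Rightarrow> 'a \<Rightarrow> 'a"
  where "gradient f x = (THE D. GDERIV f x :> D)"

lemma gradient_eq:
  assumes "GDERIV f x :> D"
  shows "gradient f x = D"
  unfolding gradient_def
proof (rule the_equality)
  fix E assume "GDERIV f x :> E"
  with assms have "(\<lambda>h. h \<bullet> E) = (\<lambda>h. h \<bullet> D)"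
    by (metis gderiv_def has_derivative_unique)
  then show "E = D"
    by (metis inner_commute vector_eq_ldot)
qed (rule assms)

lemma GDERIV_gradient:
  fixes f :: "'a::euclidean_space \<Rightarrow> real"
  assumes "f differentiable (at x)"
  shows "GDERIV f x :> gradient f x"
proof -
  obtain F where F: "(f has_derivative F) (at x)"
    using assms by (auto simp: differentiable_def)
  have lin: "linear F"
    using F by (rule has_derivative_linear)
  have "F = (\<lambda>h. h \<bullet> adjoint F 1)"
    by (auto simp: adjoint_works[OF lin])
  with F have "GDERIV f x :> adjoint F 1"
    by (simp add: gderiv_def)
  then show ?thesis
    using gradient_eq by metis
qed

text \<open>The epsilon-delta definition of absolute continuity. The finite families of
  non-overlapping compact intervals contained in \<^term>\<open>S\<close> are the divisions \<^term>\<open>d\<close> of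
  their own union with \<^prop>\<open>\<Union>d \<subseteq> S\<close>; an element \<open>k\<close> of \<open>d\<close> is the interval from
  \<^term>\<open>Inf k\<close> to \<^term>\<open>Sup k\<close>.\<close>

definition abs_continuous_on :: "real set \<Rightarrow> (real \<Rightarrow> 'a::real_normed_vector) \<Rightarrow> bool"
  where "abs_continuous_on S f \<longleftrightarrow>
    (\<forall>\<epsilon>>0. \<exists>\<delta>>0. \<forall>d. d division_of \<Union>d \<and> \<Union>d \<subseteq> S \<and> (\<Sum>k\<in>d. Sup k - Inf k) < \<delta> \<longrightarrow>
      (\<Sum>k\<in>d. norm (f (Sup k) - f (Inf k))) < \<epsilon>)"


section \<open>Size functions and proper loss functions\<close>

definition size_function :: "'a::metric_space set \<Rightarrow> 'a \<Rightarrow> ('a \<Rightarrow> real) \<Rightarrow> bool"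
  where "size_function X xbar \<omega> \<longleftrightarrow>
    continuous_on X \<omega> \<and>
    \<omega> xbar = 0 \<and> (\<forall>x\<in>X. x \<noteq> xbar \<longrightarrow> \<omega> x > 0) \<and>
    (\<forall>r\<ge>0. compact {x \<in> X. \<omega> x \<le> r})"

definition proper_loss_function :: "'a::euclidean_space set \<Rightarrow> 'a \<Rightarrow> ('a \<Rightarrow> real) \<Rightarrow> bool"
  where "proper_loss_function X xbar V \<longleftrightarrow>
    (\<forall>x\<in>X. V differentiable (at x)) \<and> continuous_on X (gradient V) \<and>
    locally_lipschitz_on X (gradient V) \<and>
    size_function X xbar (\<lambda>x. V x - V xbar) \<and>
    size_function X xbar (\<lambda>x. norm (gradient V x))"


section \<open>Comparison functions\<close>

text \<open>Comparison functions live on \<open>[0,\<infinity>)\<close>; only their values there are constrained.\<close>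

definition class_K :: "(real \<Rightarrow> real) set"
  where "class_K = {\<alpha>. \<alpha> ` {0..} \<subseteq> {0..} \<and> continuous_on {0..} \<alpha> \<and> strict_mono_on {0..} \<alpha> \<and> \<alpha> 0 = 0}"

definition class_K_inf :: "(real \<Rightarrow> real) set"
  where "class_K_inf = {\<alpha> \<in> class_K. \<not> bounded (\<alpha> ` {0..})}"

definition class_KL :: "(real \<Rightarrow> real \<Rightarrow> real) set"
  where "class_KL = {\<beta>. (\<forall>t\<ge>0. (\<lambda>r. \<beta> r t) \<in> class_K) \<and>
    (\<forall>r\<ge>0. antimono_on {0..} (\<beta> r) \<and> (\<beta> r \<longlongrightarrow> 0) at_top)}"


section \<open>Inputs, solutions, input to state stability\<close>

text \<open>Only the values of an input on \<open>[0,\<infinity>)\<close> matter. The essential supremum is taken in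
  \<^typ>\<open>ereal\<close>; for an input it is finite and nonnegative.\<close>

definition ess_norm :: "(real \<Rightarrow> 'b::euclidean_space) \<Rightarrow> ereal"
  where "ess_norm u = esssup (lebesgue_on {0..}) (\<lambda>t. ereal (norm (u t)))"

definition is_input :: "(real \<Rightarrow> 'b::euclidean_space) \<Rightarrow> bool"
  where "is_input u \<longleftrightarrow> u \<in> borel_measurable (lebesgue_on {0..}) \<and> ess_norm u < \<infinity>"

definition input_norm :: "(real \<Rightarrow> 'b::euclidean_space) \<Rightarrow> real"
  where "input_norm u = real_of_ereal (ess_norm u)"

definition control_system ::
  "'a::euclidean_space set \<Rightarrow> 'a \<Rightarrow> ('a \<Rightarrow> 'b::euclidean_space \<Rightarrow> 'a) \<Rightarrow> bool"
  where "control_system X xbar f \<longleftrightarrow>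
    locally_lipschitz_on (X \<times> UNIV) (\<lambda>(x, v). f x v) \<and> f xbar 0 = 0"

definition is_solution ::
  "'a::euclidean_space set \<Rightarrow> ('a \<Rightarrow> 'b::euclidean_space \<Rightarrow> 'a) \<Rightarrow> 'a \<Rightarrow> (real \<Rightarrow> 'b) \<Rightarrow>
    ereal \<Rightarrow> (real \<Rightarrow> 'a) \<Rightarrow> bool"
  where "is_solution X f x0 u T x \<longleftrightarrow>
    0 < T \<and> x 0 = x0 \<and>
    (\<forall>t\<ge>0. ereal t < T \<longrightarrow> x t \<in> X \<and> abs_continuous_on {0..t} x) \<and>
    (AE t in lebesgue. 0 < t \<and> ereal t < T \<longrightarrow> (x has_vector_derivative f (x t) (u t)) (at t))"

definition t_max ::
  "'a::euclidean_space set \<Rightarrow> ('a \<Rightarrow> 'b::euclidean_space \<Rightarrow> 'a) \<Rightarrow> 'a \<Rightarrow> (real \<Rightarrow> 'b) \<Rightarrow> ereal"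
  where "t_max X f x0 u = Sup {T. \<exists>x. is_solution X f x0 u T x}"

text \<open>Since \<^const>\<open>t_max\<close> is infinite, every time \<open>t \<ge> 0\<close> lies in the domain of some solution, and
  the estimate is imposed on every solution defined at \<open>t\<close>; so no uniqueness theorem is needed
  to give the definition its meaning.\<close>

definition ISS ::
  "'a::euclidean_space set \<Rightarrow> 'a \<Rightarrow> ('a \<Rightarrow> real) \<Rightarrow> ('a \<Rightarrow> 'b::euclidean_space \<Rightarrow> 'a) \<Rightarrow> bool"
  where "ISS X xbar \<omega> f \<longleftrightarrow>
    control_system X xbar f \<and>
    (\<exists>\<beta>\<in>class_KL. \<exists>\<gamma>\<in>class_K_inf. \<forall>u. is_input u \<longrightarrow> (\<forall>x0\<in>X.
      t_max X f x0 u = \<infinity> \<and>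
      (\<forall>T x. is_solution X f x0 u T x \<longrightarrow>
        (\<forall>t\<ge>0. ereal t < T \<longrightarrow> \<omega> (x t) \<le> \<beta> (\<omega> x0) t + \<gamma> (input_norm u)))))"

end

theory Submission
  imports Defs
begin

text \<open>The Lyapunov function is \<open>W = V - V xbar\<close>. Along a solution,
  \<open>W' \<le> - \<eta> |\<nabla>V|\<^sup>2 + b U |\<nabla>V|\<close> almost everywhere, where \<open>U\<close> bounds the input. Any two size
  functions dominate each other through \<open>K\<^sub>\<infinity>\<close> functions, so \<open>|\<nabla>V| \<ge> \<rho> (W)\<close> with \<open>\<rho>\<close> in \<open>K\<^sub>\<infinity>\<close>, and above the
  level \<open>L\<close> with \<open>\<rho> (L) = 2 b U / \<eta>\<close> this gives \<open>W' \<le> - \<psi> (W)\<close>, \<open>\<psi> = \<eta> \<rho>\<^sup>2 / 2\<close>. Since \<open>W\<close> decreases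
  above \<open>L\<close>, at a time \<open>t\<close> with \<open>s = W (x t) > L\<close> one has \<open>s + t \<psi> (s) \<le> W (x 0)\<close>; inverting
  \<open>s \<mapsto> s + t \<psi> (s)\<close> yields a \<open>KL\<close> bound without solving a comparison equation.
  Solutions are global because the sublevel sets of \<open>W\<close> are compact: one solves a globally Lipschitz
  cut-off of the system, whose solution never leaves the region where the cut-off is trivial.\<close>

section \<open>Absolutely continuous functions\<close>

text \<open>Solutions are merely absolutely continuous and solve the equation almost everywhere, so
  the inequality for \<open>W'\<close> cannot be fed to a mean value theorem. Two tools take its
  place: an almost everywhere derivative bound controls increments, for the estimates, and an
  indefinite integral is differentiable almost everywhere, for existence. Properness of the gradient
  norm is what lets \<open>\<rho>\<close> be unbounded, so that the level \<open>L\<close> exists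
  for every input size; with a bounded gradient norm a large input could overcome the dissipation.
  The factor 2 in the choice of \<open>L\<close> splits the dissipation
  \<open>\<eta> |\<nabla>V|^2\<close> into two halves: one absorbs the input, the other remains as
  the decay rate \<open>\<psi>\<close>. One decay lemma, with a free lower bound \<open>c0\<close>
  for the scaling of the field, serves both the ISS estimate (\<open>c0 = 1\<close>) and the
  confinement of the cut-off solution (\<open>c0 = 0\<close>).\<close>

lemma abs_continuous_onD:
  assumes "abs_continuous_on S f" "\<epsilon> > 0"
  obtains \<delta> where "\<delta> > 0"
    "\<forall>d. d division_of \<Union>d \<longrightarrow> \<Union>d \<subseteq> S \<longrightarrow> (\<Sum>k\<in>d. Sup k - Inf k) < \<delta> \<longrightarrow>
      (\<Sum>k\<in>d. norm (f (Sup k) - f (Inf k))) < \<epsilon>"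
proof -
  have "\<exists>\<delta>>0. \<forall>d. d division_of \<Union>d \<longrightarrow> \<Union>d \<subseteq> S \<longrightarrow> (\<Sum>k\<in>d. Sup k - Inf k) < \<delta> \<longrightarrow>
      (\<Sum>k\<in>d. norm (f (Sup k) - f (Inf k))) < \<epsilon>"
    using assms unfolding abs_continuous_on_def imp_conjL by simp
  then show ?thesis using that by (elim exE conjE)
qed

lemma abs_continuous_onI:
  assumes "\<And>\<epsilon>. \<epsilon> > 0 \<Longrightarrow> \<exists>\<delta>>0. \<forall>d. d division_of \<Union>d \<longrightarrow> \<Union>d \<subseteq> S \<longrightarrow> (\<Sum>k\<in>d. Sup k - Inf k) < \<delta> \<longrightarrow>
      (\<Sum>k\<in>d. norm (f (Sup k) - f (Inf k))) < \<epsilon>"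
  shows "abs_continuous_on S f"
  unfolding abs_continuous_on_def imp_conjL using assms by simp

lemma abs_continuous_on_subset:
  assumes f: "abs_continuous_on S f" and "T \<subseteq> S"
  shows "abs_continuous_on T f"
proof (rule abs_continuous_onI)
  fix \<epsilon> :: real assume "\<epsilon> > 0"
  with f obtain \<delta> where "\<delta> > 0"
    "\<forall>d. d division_of \<Union>d \<longrightarrow> \<Union>d \<subseteq> S \<longrightarrow> (\<Sum>k\<in>d. Sup k - Inf k) < \<delta> \<longrightarrow>
      (\<Sum>k\<in>d. norm (f (Sup k) - f (Inf k))) < \<epsilon>"
    by (rule abs_continuous_onD)
  moreover have "\<Union>d \<subseteq> T \<Longrightarrow> \<Union>d \<subseteq> S" for d using \<open>T \<subseteq> S\<close> by blast
  ultimately show "\<exists>\<delta>>0. \<forall>d. d division_of \<Union>d \<longrightarrow> \<Union>d \<subseteq> T \<longrightarrow> (\<Sum>k\<in>d. Sup k - Inf k) < \<delta> \<longrightarrow>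
      (\<Sum>k\<in>d. norm (f (Sup k) - f (Inf k))) < \<epsilon>"
    by (intro exI[of _ \<delta>] conjI allI impI) auto
qed

lemma division_real_mem:
  fixes d :: "real set set"
  assumes "d division_of D" "k \<in> d" "D \<subseteq> S"
  shows "Inf k \<le> Sup k" "Inf k \<in> S" "Sup k \<in> S"
proof -
  obtain a b where "k = cbox a b" "k \<noteq> {}" "k \<subseteq> D"
    by (rule cbox_division_memE[OF assms(2,1)])
  then have "k = {a..b}" "a \<le> b" "k \<subseteq> S" using assms(3) by auto
  then show "Inf k \<le> Sup k" "Inf k \<in> S" "Sup k \<in> S" by auto
qed

lemma lipschitz_imp_abs_continuous_on:
  fixes f :: "real \<Rightarrow> 'a::real_normed_vector"
  assumes "L-lipschitz_on S f"
  shows "abs_continuous_on S f"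
proof (rule abs_continuous_onI)
  fix \<epsilon> :: real assume "\<epsilon> > 0"
  have "L \<ge> 0" using assms by (rule lipschitz_on_nonneg)
  show "\<exists>\<delta>>0. \<forall>d. d division_of \<Union>d \<longrightarrow> \<Union>d \<subseteq> S \<longrightarrow> (\<Sum>k\<in>d. Sup k - Inf k) < \<delta> \<longrightarrow>
          (\<Sum>k\<in>d. norm (f (Sup k) - f (Inf k))) < \<epsilon>"
  \<comment> \<open>\<open>L + 1\<close> in place of \<open>L\<close> keeps the quotient meaningful
    when \<open>L = 0\<close>, and makes the last inequality strict.\<close>
  proof (intro exI[of _ "\<epsilon> / (L + 1)"] conjI allI impI)
    show "\<epsilon> / (L + 1) > 0" using \<open>\<epsilon> > 0\<close> \<open>L \<ge> 0\<close> by simp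
    fix d assume d: "d division_of \<Union>d" "\<Union>d \<subseteq> S" "(\<Sum>k\<in>d. Sup k - Inf k) < \<epsilon> / (L + 1)"
    have *: "norm (f (Sup k) - f (Inf k)) \<le> L * (Sup k - Inf k) \<and> 0 \<le> Sup k - Inf k" if "k \<in> d" for k
    proof -
      have k: "Inf k \<le> Sup k" "Inf k \<in> S" "Sup k \<in> S"
        using division_real_mem[OF d(1) that d(2)] by auto
      then show ?thesis
        using lipschitz_on_normD[OF assms k(3,2)] by auto
    qed
    have "(\<Sum>k\<in>d. norm (f (Sup k) - f (Inf k))) \<le> L * (\<Sum>k\<in>d. Sup k - Inf k)"
      unfolding sum_distrib_left using * by (intro sum_mono) auto
    also have "\<dots> \<le> (L + 1) * (\<Sum>k\<in>d. Sup k - Inf k)"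
      using * by (intro mult_right_mono sum_nonneg) auto
    also have "\<dots> < \<epsilon>"
      using d(3) \<open>L \<ge> 0\<close> by (simp add: field_simps)
    finally show "(\<Sum>k\<in>d. norm (f (Sup k) - f (Inf k))) < \<epsilon>" .
  qed
qed

text \<open>The outer function need only be Lipschitz on the image of \<open>f\<close>. For a
  trajectory on a compact time interval this image is compact, so local Lipschitz continuity of the
  loss is enough to make the loss along the trajectory absolutely continuous.\<close>

lemma abs_continuous_on_compose_lipschitz:
  fixes f :: "real \<Rightarrow> 'a::real_normed_vector" and g :: "'a \<Rightarrow> 'b::real_normed_vector"
  assumes f: "abs_continuous_on S f" and g: "L-lipschitz_on (f ` S) g"
  shows "abs_continuous_on S (\<lambda>t. g (f t))"
proof (rule abs_continuous_onI)
  fix \<epsilon> :: real assume "\<epsilon> > 0"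
  have "L \<ge> 0" using g by (rule lipschitz_on_nonneg)
  then have "\<epsilon> / (L + 1) > 0" using \<open>\<epsilon> > 0\<close> by simp
  with f obtain \<delta> where \<delta>: "\<delta> > 0"
    "\<forall>d. d division_of \<Union>d \<longrightarrow> \<Union>d \<subseteq> S \<longrightarrow> (\<Sum>k\<in>d. Sup k - Inf k) < \<delta> \<longrightarrow>
      (\<Sum>k\<in>d. norm (f (Sup k) - f (Inf k))) < \<epsilon> / (L + 1)"
    by (rule abs_continuous_onD)
  show "\<exists>\<delta>>0. \<forall>d. d division_of \<Union>d \<longrightarrow> \<Union>d \<subseteq> S \<longrightarrow> (\<Sum>k\<in>d. Sup k - Inf k) < \<delta> \<longrightarrow>
          (\<Sum>k\<in>d. norm (g (f (Sup k)) - g (f (Inf k)))) < \<epsilon>"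
  proof (intro exI[of _ \<delta>] conjI allI impI)
    show "\<delta> > 0" by fact
    fix d assume d: "d division_of \<Union>d" "\<Union>d \<subseteq> S" "(\<Sum>k\<in>d. Sup k - Inf k) < \<delta>"
    have *: "norm (g (f (Sup k)) - g (f (Inf k))) \<le> L * norm (f (Sup k) - f (Inf k))" if "k \<in> d" for k
    proof -
      have "Inf k \<in> S" "Sup k \<in> S"
        using division_real_mem[OF d(1) that d(2)] by auto
      then show ?thesis
        by (intro lipschitz_on_normD[OF g]) auto
    qed
    have "(\<Sum>k\<in>d. norm (g (f (Sup k)) - g (f (Inf k)))) \<le> L * (\<Sum>k\<in>d. norm (f (Sup k) - f (Inf k)))"
      unfolding sum_distrib_left using * by (intro sum_mono) auto
    also have "\<dots> \<le> (L + 1) * (\<Sum>k\<in>d. norm (f (Sup k) - f (Inf k)))"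
      by (intro mult_right_mono sum_nonneg) auto
    also have "\<dots> < \<epsilon>"
      using \<delta>(2)[rule_format, OF d] \<open>L \<ge> 0\<close> by (simp add: field_simps)
    finally show "(\<Sum>k\<in>d. norm (g (f (Sup k)) - g (f (Inf k)))) < \<epsilon>" .
  qed
qed

lemma abs_continuous_on_imp_continuous_on:
  fixes f :: "real \<Rightarrow> 'a::real_normed_vector"
  assumes "abs_continuous_on {a..b} f"
  shows "continuous_on {a..b} f"
  unfolding continuous_on_iff
proof (intro ballI allI impI)
  fix s e :: real assume s: "s \<in> {a..b}" and "e > 0"
  from assms \<open>e > 0\<close> obtain \<delta> where \<delta>: "\<delta> > 0"
    "\<forall>d. d division_of \<Union>d \<longrightarrow> \<Union>d \<subseteq> {a..b} \<longrightarrow> (\<Sum>k\<in>d. Sup k - Inf k) < \<delta> \<longrightarrow>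
      (\<Sum>k\<in>d. norm (f (Sup k) - f (Inf k))) < e"
    by (rule abs_continuous_onD)
  have *: "norm (f v - f u) < e" if "u \<le> v" "a \<le> u" "v \<le> b" "v - u < \<delta>" for u v
  proof -
    \<comment> \<open>Tested on divisions with a single interval, absolute continuity is uniform
      continuity.\<close>
    have "{{u..v}} division_of \<Union>{{u..v}}"
      using division_of_self[of u v] that by simp
    from \<delta>(2)[rule_format, OF this] that show ?thesis by (simp add: cSup_atLeastAtMost)
  qed
  show "\<exists>d>0. \<forall>x'\<in>{a..b}. dist x' s < d \<longrightarrow> dist (f x') (f s) < e"
  proof (intro exI[of _ \<delta>] conjI ballI impI \<delta>(1))
    fix t assume "t \<in> {a..b}" "dist t s < \<delta>"
    then show "dist (f t) (f s) < e"
      using *[of s t] *[of t s] s by (cases "s \<le> t") (auto simp: dist_norm norm_minus_commute)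
  qed
qed

section \<open>Growth bounds from an almost everywhere bound on the derivative\<close>

text \<open>A gauge that is governed by the derivative off the exceptional null set, and by an open
  cover of small measure on it, replaces the Vitali covering argument: in a fine tagged division
  the intervals with exceptional tags have small total length.\<close>

lemma abs_continuous_on_increment_le:
  fixes f :: "real \<Rightarrow> real"
  assumes "a \<le> b" and ac: "abs_continuous_on {a..b} f"
    and ae: "AE t in lebesgue. a < t \<and> t < b \<longrightarrow> (\<exists>D\<le>c. (f has_real_derivative D) (at t))"
  shows "f b - f a \<le> c * (b - a)"
proof (rule field_le_epsilon)
  fix e :: real assume "e > 0"
  \<comment> \<open>The errors below add up to
    \<open>\<epsilon> * (b - a + \<bar>c\<bar> + 1)\<close>: \<open>\<epsilon> * (b - a)\<close>
    from differentiation at the good tags, \<open>\<bar>c\<bar> * \<epsilon>\<close> from the length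
    missing there, and \<open>\<epsilon>\<close> from the increments over the exceptional
    intervals.\<close>
  define \<epsilon> where "\<epsilon> = e / (b - a + \<bar>c\<bar> + 2)"
  have den: "b - a + \<bar>c\<bar> + 2 > 0" using \<open>a \<le> b\<close> by linarith
  have "\<epsilon> > 0" unfolding \<epsilon>_def using den \<open>e > 0\<close> by simp
  obtain \<delta>0 where \<delta>0: "\<delta>0 > 0"
    "\<forall>d. d division_of \<Union>d \<longrightarrow> \<Union>d \<subseteq> {a..b} \<longrightarrow> (\<Sum>k\<in>d. Sup k - Inf k) < \<delta>0 \<longrightarrow>
      (\<Sum>k\<in>d. norm (f (Sup k) - f (Inf k))) < \<epsilon>"
    using ac \<open>\<epsilon> > 0\<close> by (rule abs_continuous_onD)
  define \<delta> where "\<delta> = min \<delta>0 \<epsilon>"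
  have \<delta>: "\<delta> > 0" "\<delta> \<le> \<delta>0" "\<delta> \<le> \<epsilon>" using \<delta>0 \<open>\<epsilon> > 0\<close> by (auto simp: \<delta>_def)
  obtain N0 where N0: "negligible N0"
    "{t. \<not> (a < t \<and> t < b \<longrightarrow> (\<exists>D\<le>c. (f has_real_derivative D) (at t)))} \<subseteq> N0"
    using ae unfolding eventually_ae_filter_negligible by blast
  \<comment> \<open>Nothing is assumed about derivatives at the end points, so they count as
    exceptional.\<close>
  define N where "N = N0 \<union> {a, b}"
  have N: "negligible N" unfolding N_def using N0(1) by (intro negligible_Un) auto
  have Nm: "N \<in> sets lebesgue" using N by (simp add: negligible_imp_sets)
  obtain G where G: "open G" "N \<subseteq> G" "G - N \<in> lmeasurable" "emeasure lebesgue (G - N) < ennreal \<delta>"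
    using sets_lebesgue_outer_open[OF Nm \<delta>(1)] by blast
  have GG: "G = N \<union> (G - N)" using G(2) by blast
  have Gl: "G \<in> lmeasurable"
    by (subst GG) (intro fmeasurable.Un G negligible_imp_measurable N)
  have "measure lebesgue G \<le> measure lebesgue N + measure lebesgue (G - N)"
    by (subst GG) (intro measure_Un_le Nm fmeasurableD[OF G(3)])
  also have "measure lebesgue N = 0" using N by (simp add: negligible_imp_measure0)
  also have "measure lebesgue (G - N) < \<delta>"
    using G(4) \<delta>(1) emeasure_eq_measure2[OF G(3)] by (simp add: ennreal_less_iff)
  finally have Gm: "measure lebesgue G < \<delta>" by simp
  \<comment> \<open>Straddle estimate: with the tag between \<open>u\<close> and \<open>v\<close>,
    the errors at the two ends add up to \<open>\<epsilon> * (v - u)\<close>; without this position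
    they would not be controlled by the length of the interval.\<close>
  have "\<exists>r>0. \<forall>u v. u \<le> t \<and> t \<le> v \<and> {u..v} \<subseteq> ball t r \<longrightarrow> f v - f u \<le> (c + \<epsilon>) * (v - u)"
    if "t \<in> {a..b} - N" for t
  proof -
    have "a < t \<and> t < b" "t \<notin> N0"
      using that by (auto simp: N_def)
    then obtain D where D: "D \<le> c" "(f has_real_derivative D) (at t)"
      using N0(2) by blast
    then obtain r where r: "r > 0"
      "\<And>y. \<bar>y - t\<bar> < r \<Longrightarrow> \<bar>f y - f t - D * (y - t)\<bar> \<le> \<epsilon> * \<bar>y - t\<bar>"
      using \<open>\<epsilon> > 0\<close> unfolding has_field_derivative_def has_derivative_at_alt
      by (metis real_norm_def)
    show ?thesis
    proof (intro exI conjI allI impI; (elim conjE)?)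
      show "r > 0" by fact
      fix u v assume *: "u \<le> t" "t \<le> v" "{u..v} \<subseteq> ball t r"
      have "u \<in> ball t r" "v \<in> ball t r"
        using * by (auto intro: subsetD[OF *(3)] simp del: mem_ball)
      then have "\<bar>u - t\<bar> < r" "\<bar>v - t\<bar> < r" by (auto simp: dist_real_def)
      from r(2)[OF this(1)] r(2)[OF this(2)] *
      have "f v - f u \<le> D * (v - u) + \<epsilon> * (v - u)"
        by (simp add: abs_le_iff algebra_simps)
      also have "\<dots> \<le> c * (v - u) + \<epsilon> * (v - u)"
        using * D(1) by (intro add_right_mono mult_right_mono) auto
      finally show "f v - f u \<le> (c + \<epsilon>) * (v - u)" by (simp add: algebra_simps)
    qed
  qed
  then obtain r where r: "\<And>t. t \<in> {a..b} - N \<Longrightarrow> r t > 0"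
    "\<And>t u v. t \<in> {a..b} - N \<Longrightarrow> u \<le> t \<Longrightarrow> t \<le> v \<Longrightarrow> {u..v} \<subseteq> ball t (r t) \<Longrightarrow>
      f v - f u \<le> (c + \<epsilon>) * (v - u)"
    by metis
  define g where "g t = (if t \<in> N then G else if t \<in> {a..b} then ball t (r t) else UNIV)" for t
  have "gauge g"
    using G r(1) by (auto simp: gauge_def g_def)
  then obtain p where p: "p tagged_division_of {a..b}" "g fine p"
    by (rule fine_division_exists_real)
  have pK: "K = {Inf K..Sup K}" "Inf K \<le> t" "t \<le> Sup K" "{Inf K..Sup K} \<subseteq> {a..b}" "{Inf K..Sup K} \<subseteq> g t"
    if tK: "(t, K) \<in> p" for t K
  proof -
    have tK': "t \<in> K" "K \<subseteq> {a..b}" "\<exists>u v. K = cbox u v"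
      using p(1) tK unfolding tagged_division_of by blast+
    moreover have sub: "K \<subseteq> g t" using p(2) tK by (rule fineD)
    moreover obtain u v where uv: "K = {u..v}" using tK' by auto
    moreover have "u \<le> v" using tK'(1) uv by auto
    ultimately have IS: "Inf K = u" "Sup K = v" by auto
    show "K = {Inf K..Sup K}" "Inf K \<le> t" "t \<le> Sup K" "{Inf K..Sup K} \<subseteq> {a..b}" "{Inf K..Sup K} \<subseteq> g t"
      unfolding IS using tK' sub uv by auto
  qed
  have fin: "finite p" using p(1) by (rule tagged_division_of_finite)
  define q where "q = {x \<in> p. fst x \<in> N}"
  have q: "q \<subseteq> p" "finite q" using fin by (auto simp: q_def)
  have pd: "snd ` q division_of \<Union>(snd ` q)"
    using p(1) q(1) unfolding tagged_division_of_def
    by (auto intro: partial_division_of_tagged_division[OF tagged_partial_division_subset])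
  \<comment> \<open>Sums over tagged intervals are to become sums over intervals. An interval with
    two tags would have empty interior, hence be a single point, and then the two tags
    agree.\<close>
  have inj: "inj_on snd q"
  proof (rule inj_onI, clarsimp)
    fix s t K assume st: "(s, K) \<in> q" "(t, K) \<in> q"
    show "s = t"
    proof (rule ccontr)
      assume "s \<noteq> t"
      then have "interior K \<inter> interior K = {}"
        using tagged_division_ofD(5)[OF p(1), of s K t K] st q(1) by blast
      then have "interior {Inf K..Sup K} = {}"
        using pK(1)[OF subsetD[OF q(1) st(1)]] by (metis Int_absorb)
      then have "Sup K \<le> Inf K" by (simp add: interior_atLeastAtMost_real)
      then show False
        using pK(2,3)[of s K] pK(2,3)[of t K] st q(1) \<open>s \<noteq> t\<close> by (auto dest!: subsetD[OF q(1)])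
    qed
  qed
  have subG: "\<Union>(snd ` q) \<subseteq> G"
  proof (rule Union_least, clarify)
    fix t K x assume "(t, K) \<in> q" "x \<in> snd (t, K)"
    then have "(t, K) \<in> p" "t \<in> N" "x \<in> K" by (auto simp: q_def)
    then show "x \<in> G" using fineD[OF p(2), of t K] by (auto simp: g_def)
  qed
  have subab: "\<Union>(snd ` q) \<subseteq> {a..b}"
  proof (rule Union_least, clarify)
    fix t K x assume "(t, K) \<in> q" "x \<in> snd (t, K)"
    then show "x \<in> {a..b}" using tagged_division_ofD(3)[OF p(1), of t K] by (auto simp: q_def)
  qed
  have len: "measure lebesgue K = Sup K - Inf K" "0 \<le> Sup K - Inf K" if "(t, K) \<in> q" for t K
  proof -
    have "(t, K) \<in> p" using that q(1) by blast
    then have *: "Inf K \<le> Sup K" using pK(2,3)[of t K] by linarith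
    show "0 \<le> Sup K - Inf K" using * by simp
    show "measure lebesgue K = Sup K - Inf K"
      by (subst pK(1)[OF \<open>(t, K) \<in> p\<close>]) (use * in simp)
  qed
  have "(\<Sum>k\<in>snd ` q. Sup k - Inf k) = (\<Sum>k\<in>snd ` q. measure lebesgue k)"
    using len by (intro sum.cong) auto
  also have "\<dots> = measure lebesgue (\<Union>(snd ` q))"
    by (rule content_division[OF pd])
  also have "\<dots> \<le> measure lebesgue G"
    using subG pd Gl by (intro measure_mono_fmeasurable) (auto intro: lmeasurable_division fmeasurableD)
  also have "\<dots> < \<delta>" by (rule Gm)
  finally have small: "(\<Sum>k\<in>snd ` q. Sup k - Inf k) < \<delta>" .
  have "(\<Sum>(t,K)\<in>q. f (Sup K) - f (Inf K)) = (\<Sum>K\<in>snd ` q. f (Sup K) - f (Inf K))"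
    using sum.reindex[OF inj, of "\<lambda>K. f (Sup K) - f (Inf K)"] by (simp add: case_prod_unfold)
  also have "\<dots> \<le> (\<Sum>K\<in>snd ` q. norm (f (Sup K) - f (Inf K)))"
    by (intro sum_mono) auto
  also have "\<dots> < \<epsilon>"
    using small \<delta> by (intro \<delta>0(2)[rule_format] pd subab) auto
  finally have sum1: "(\<Sum>(t,K)\<in>q. f (Sup K) - f (Inf K)) < \<epsilon>" .
  have "(\<Sum>(t,K)\<in>q. Sup K - Inf K) = (\<Sum>K\<in>snd ` q. Sup K - Inf K)"
    using sum.reindex[OF inj, of "\<lambda>K. Sup K - Inf K"] by (simp add: case_prod_unfold)
  then have lenq: "(\<Sum>(t,K)\<in>q. Sup K - Inf K) < \<delta>" using small by simp
  define l where "l = (\<Sum>(t,K)\<in>q. Sup K - Inf K)"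
  have lenq0: "0 \<le> (\<Sum>(t,K)\<in>q. Sup K - Inf K)"
    using len(2) by (intro sum_nonneg) auto
  have "(\<Sum>(t,K)\<in>p - q. f (Sup K) - f (Inf K)) \<le> (\<Sum>(t,K)\<in>p - q. (c + \<epsilon>) * (Sup K - Inf K))"
  proof (intro sum_mono, clarify)
    fix t K assume tK: "(t, K) \<in> p" "(t, K) \<notin> q"
    then have "t \<notin> N" by (auto simp: q_def)
    moreover have "t \<in> {a..b}" using tag_in_interval[OF p(1) tK(1)] .
    ultimately show "f (Sup K) - f (Inf K) \<le> (c + \<epsilon>) * (Sup K - Inf K)"
      using pK(5)[OF tK(1)] by (intro r(2)[of t] pK(2,3)[OF tK(1)]) (simp_all add: g_def)
  qed
  also have "\<dots> = (c + \<epsilon>) * (\<Sum>(t,K)\<in>p - q. Sup K - Inf K)"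
    by (simp add: sum_distrib_left case_prod_unfold)
  also have "(\<Sum>(t,K)\<in>p - q. Sup K - Inf K) = (b - a) - (\<Sum>(t,K)\<in>q. Sup K - Inf K)"
    using additive_tagged_division_1[OF \<open>a \<le> b\<close> p(1), of "\<lambda>x. x"] fin q(1)
    by (simp add: sum_diff)
  finally have sum2: "(\<Sum>(t,K)\<in>p - q. f (Sup K) - f (Inf K)) \<le> (c + \<epsilon>) * ((b - a) - (\<Sum>(t,K)\<in>q. Sup K - Inf K))" .
  have "f b - f a = (\<Sum>(t,K)\<in>p - q. f (Sup K) - f (Inf K)) + (\<Sum>(t,K)\<in>q. f (Sup K) - f (Inf K))"
    using additive_tagged_division_1[OF \<open>a \<le> b\<close> p(1), of f] fin q(1) by (simp add: sum_diff)
  also have "\<dots> \<le> (c + \<epsilon>) * ((b - a) - (\<Sum>(t,K)\<in>q. Sup K - Inf K)) + \<epsilon>"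
    using sum1 sum2 by linarith
  also have "\<dots> = (c + \<epsilon>) * ((b - a) - l) + \<epsilon>" by (simp add: l_def)
  \<comment> \<open>The length \<open>l\<close> of the exceptional intervals is missing from the
    main sum; since \<open>l < \<epsilon>\<close>, restoring it costs at most
    \<open>\<bar>c\<bar> * \<epsilon>\<close>, whatever the sign of \<open>c\<close>.\<close>
  also have "\<dots> \<le> (c + \<epsilon>) * (b - a) + \<bar>c\<bar> * \<epsilon> + \<epsilon>"
  proof -
    have "\<bar>c * l\<bar> = \<bar>c\<bar> * l" using lenq0 by (simp add: l_def abs_mult)
    moreover have "\<bar>c\<bar> * l \<le> \<bar>c\<bar> * \<epsilon>"
      using lenq \<delta>(3) by (intro mult_left_mono) (auto simp: l_def)
    moreover have "0 \<le> \<epsilon> * l" using lenq0 \<open>\<epsilon> > 0\<close> by (simp add: l_def)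
    moreover have "(c + \<epsilon>) * ((b - a) - l) = (c + \<epsilon>) * (b - a) - c * l - \<epsilon> * l"
      by (simp add: algebra_simps)
    ultimately show ?thesis by linarith
  qed
  also have "\<dots> = c * (b - a) + \<epsilon> * (b - a + \<bar>c\<bar> + 1)" by (simp add: algebra_simps)
  also have "\<dots> \<le> c * (b - a) + \<epsilon> * (b - a + \<bar>c\<bar> + 2)" using \<open>\<epsilon> > 0\<close> by simp
  also have "\<dots> = c * (b - a) + e" unfolding \<epsilon>_def using den by simp
  finally show "f b - f a \<le> c * (b - a) + e" .
qed


section \<open>Differentiation of the indefinite integral\<close>

text \<open>A bad point \<open>t\<close> is an end of arbitrarily short intervals on which
  \<open>f t\<close> times the length misses the integral by more than \<open>\<epsilon>\<close>
  times the length. Vitali's lemma selects disjoint ones whose fivefold enlargements cover the bad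
  set; Henstock's lemma bounds the sum of their errors, and therefore their total length.\<close>

lemma negligible_integral_not_approximable:
  fixes f :: "real \<Rightarrow> 'a::euclidean_space"
  assumes f: "f integrable_on {a..b}" and "\<epsilon> > 0"
  defines "F \<equiv> \<lambda>x. integral {a..x} f"
  shows "negligible {t \<in> {a<..<b}. \<forall>d>0. \<exists>y. \<bar>y - t\<bar> < d \<and>
    norm (F y - F t - (y - t) *\<^sub>R f t) > \<epsilon> * \<bar>y - t\<bar>}" (is "negligible ?E")
  unfolding negligible_outer_le
proof (intro allI impI)
  fix \<delta> :: real assume "\<delta> > 0"
  \<comment> \<open>Division by \<open>\<epsilon>\<close> converts errors into lengths; the 5 pays
    for the enlargement in Vitali's lemma.\<close>
  have pos: "\<delta> * \<epsilon> / 5 > 0" using \<open>\<delta> > 0\<close> \<open>\<epsilon> > 0\<close> by simp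
  have "f integrable_on cbox a b" using f by simp
  from Henstock_lemma[OF this pos] obtain \<gamma> where "gauge \<gamma>" and
    \<gamma>: "\<And>p. p tagged_partial_division_of (cbox a b) \<Longrightarrow> \<gamma> fine p \<Longrightarrow>
             (\<Sum>(x,k)\<in>p. norm (measure lborel k *\<^sub>R f x - integral k f)) < \<delta> * \<epsilon> / 5"
    by blast
  define I where "I t y = {min t y..max t y}" for t y :: real
  have ex: "\<exists>y. y \<noteq> t \<and> I t y \<subseteq> \<gamma> t \<and> I t y \<subseteq> {a..b} \<and>
      norm (measure lborel (I t y) *\<^sub>R f t - integral (I t y) f) > \<epsilon> * \<bar>y - t\<bar>" if t: "t \<in> ?E" for t
  proof -
    have "open (\<gamma> t \<inter> {a<..<b})" "t \<in> \<gamma> t \<inter> {a<..<b}"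
      using \<open>gauge \<gamma>\<close> t by (auto simp: gauge_def)
    then obtain d where d: "d > 0" "ball t d \<subseteq> \<gamma> t \<inter> {a<..<b}"
      by (rule openE)
    obtain y where y: "\<bar>y - t\<bar> < d" "norm (F y - F t - (y - t) *\<^sub>R f t) > \<epsilon> * \<bar>y - t\<bar>"
      using t d(1) by blast
    have "I t y \<subseteq> ball t d"
      using y(1) by (auto simp: I_def dist_real_def)
    then have sub: "I t y \<subseteq> \<gamma> t" "I t y \<subseteq> {a<..<b}" using d(2) by auto
    then have ty: "t \<in> {a<..<b}" "y \<in> {a<..<b}"
      using subsetD[OF sub(2), of t] subsetD[OF sub(2), of y] by (auto simp: I_def)
    have Fdiff: "F v - F u = integral {u..v} f" if "u \<le> v" "u \<in> {a<..<b}" "v \<in> {a<..<b}" for u v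
    proof -
      have "f integrable_on {a..v}"
        using f that by (auto intro: integrable_subinterval_real)
      from Henstock_Kurzweil_Integration.integral_combine[OF _ _ this, of u] that show ?thesis
        by (auto simp: F_def algebra_simps)
    qed
    have "norm (F y - F t - (y - t) *\<^sub>R f t) = norm (measure lborel (I t y) *\<^sub>R f t - integral (I t y) f)"
    proof (cases "t \<le> y")
      case True
      then show ?thesis using Fdiff[of t y] ty by (simp add: I_def norm_minus_commute)
    next
      case False
      then have "F y - F t = - integral {y..t} f" using Fdiff[of y t] ty by (simp add: algebra_simps)
      then have "F y - F t - (y - t) *\<^sub>R f t = (t - y) *\<^sub>R f t - integral {y..t} f"
        by (simp add: scaleR_diff_left)
      with False show ?thesis by (simp add: I_def)
    qed
    moreover have "y \<noteq> t" using y(2) by auto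
    ultimately show ?thesis using y sub by (intro exI[of _ y]) auto
  qed
  define y where "y t = (SOME y. y \<noteq> t \<and> I t y \<subseteq> \<gamma> t \<and> I t y \<subseteq> {a..b} \<and>
      norm (measure lborel (I t y) *\<^sub>R f t - integral (I t y) f) > \<epsilon> * \<bar>y - t\<bar>)" for t
  have y: "y t \<noteq> t" "I t (y t) \<subseteq> \<gamma> t" "I t (y t) \<subseteq> {a..b}"
      "norm (measure lborel (I t (y t)) *\<^sub>R f t - integral (I t (y t)) f) > \<epsilon> * \<bar>y t - t\<bar>" if "t \<in> ?E" for t
    using someI_ex[OF ex[OF that], folded y_def] by blast+
  \<comment> \<open>The covering lemma is about balls, hence centres and radii.\<close>
  define c where "c t = (t + y t) / 2" for t
  define r where "r t = \<bar>y t - t\<bar> / 2" for t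
  have I_eq: "I t (y t) = cball (c t) (r t)" for t
    by (cases "t \<le> y t") (simp_all add: I_def c_def r_def cball_eq_atLeastAtMost field_simps)
  have r: "0 < r t \<and> r t \<le> b - a" if "t \<in> ?E" for t
  proof -
    have "t \<in> {a..b}" "y t \<in> {a..b}" 
      using subsetD[OF y(3)[OF that], of t] subsetD[OF y(3)[OF that], of "y t"] by (auto simp: I_def)
    then show ?thesis using y(1)[OF that] by (auto simp: r_def abs_if)
  qed
  have tI: "t \<in> I t (y t)" for t by (auto simp: I_def)
  have "?E \<subseteq> (\<Union>t\<in>?E. cball (c t) (r t))" using tI unfolding I_eq by blast
  then obtain C where C: "countable C" "C \<subseteq> ?E"
     "pairwise (\<lambda>i j. disjnt (cball (c i) (r i)) (cball (c j) (r j))) C"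
     "?E \<subseteq> (\<Union>t\<in>C. cball (c t) (5 * r t))"
    by (rule Vitali_covering_lemma_cballs) (rule r)
  \<comment> \<open>Henstock's lemma concerns finite families; a bound uniform over the finite
    subfamilies passes to the countable union.\<close>
  have le: "measure lebesgue (\<Union>t\<in>C'. cball (c t) (5 * r t)) \<le> \<delta>" if C': "C' \<subseteq> C" "finite C'" for C'
  proof -
    define p where "p = (\<lambda>t. (t, I t (y t))) ` C'"
    have inj: "inj_on (\<lambda>t. (t, I t (y t))) C'" by (auto simp: inj_on_def)
    have "p tagged_partial_division_of cbox a b"
      unfolding tagged_partial_division_of_def
    proof (intro conjI allI impI)
      show "finite p" using C' by (simp add: p_def)
    next
      fix x K assume "(x, K) \<in> p"
      then have xK: "x \<in> C'" "K = I x (y x)" by (auto simp: p_def)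
      then have "x \<in> ?E" using C' C(2) by blast
      show "x \<in> K" using xK tI by simp
      show "K \<subseteq> cbox a b" using y(3)[OF \<open>x \<in> ?E\<close>] xK by simp
      show "\<exists>a b. K = cbox a b" using xK by (auto simp: I_def)
    next
      fix x1 K1 x2 K2 assume "(x1, K1) \<in> p \<and> (x2, K2) \<in> p \<and> (x1, K1) \<noteq> (x2, K2)"
      then have "x1 \<in> C" "x2 \<in> C" "x1 \<noteq> x2" "K1 = I x1 (y x1)" "K2 = I x2 (y x2)"
        using C'(1) by (auto simp: p_def)
      then have "disjnt K1 K2" using C(3) by (simp add: pairwise_def I_eq)
      then show "interior K1 \<inter> interior K2 = {}"
        using interior_subset[of K1] interior_subset[of K2] by (auto simp: disjnt_def)
    qed
    moreover have "\<gamma> fine p"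
      using y(2)[OF subsetD[OF C(2)]] C'(1) unfolding fine_def p_def by blast
    ultimately have "(\<Sum>(x,k)\<in>p. norm (measure lborel k *\<^sub>R f x - integral k f)) < \<delta> * \<epsilon> / 5"
      by (rule \<gamma>)
    then have *: "(\<Sum>t\<in>C'. norm (measure lborel (I t (y t)) *\<^sub>R f t - integral (I t (y t)) f)) < \<delta> * \<epsilon> / 5"
      unfolding p_def by (simp add: sum.reindex[OF inj])
    have "(\<Sum>t\<in>C'. \<epsilon> * \<bar>y t - t\<bar>) \<le> (\<Sum>t\<in>C'. norm (measure lborel (I t (y t)) *\<^sub>R f t - integral (I t (y t)) f))"
      by (intro sum_mono less_imp_le y(4) subsetD[OF C(2)] subsetD[OF C'(1)])
    also note *
    also have "\<delta> * \<epsilon> / 5 = \<epsilon> * (\<delta> / 5)" by simp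
    finally have "\<epsilon> * (\<Sum>t\<in>C'. \<bar>y t - t\<bar>) < \<epsilon> * (\<delta> / 5)" by (simp only: sum_distrib_left)
    then have **: "(\<Sum>t\<in>C'. \<bar>y t - t\<bar>) < \<delta> / 5" using \<open>\<epsilon> > 0\<close> by simp
    have "measure lebesgue (\<Union>t\<in>C'. cball (c t) (5 * r t)) \<le> (\<Sum>t\<in>C'. measure lebesgue (cball (c t) (5 * r t)))"
      using C'(2) by (intro measure_UNION_le) auto
    also have "\<dots> = (\<Sum>t\<in>C'. 5 * \<bar>y t - t\<bar>)"
      by (intro sum.cong) (auto simp: cball_eq_atLeastAtMost r_def)
    also have "\<dots> \<le> \<delta>" using ** by (simp flip: sum_distrib_left)
    finally show ?thesis .
  qed
  show "\<exists>T. ?E \<subseteq> T \<and> T \<in> lmeasurable \<and> measure lebesgue T \<le> \<delta>"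
  proof (intro exI conjI)
    show "?E \<subseteq> (\<Union>t\<in>C. cball (c t) (5 * r t))" by (rule C)
    show "(\<Union>t\<in>C. cball (c t) (5 * r t)) \<in> lmeasurable"
      by (rule fmeasurable_UN_bound[OF C(1) _ le]) auto
    show "measure lebesgue (\<Union>t\<in>C. cball (c t) (5 * r t)) \<le> \<delta>"
      by (rule measure_UN_bound[OF C(1) _ le]) auto
  qed
qed

text \<open>If \<open>f t\<close> is not the derivative at \<open>t\<close>, the linear
  approximation already fails with some tolerance \<open>1 / (n + 1)\<close>, so the exceptional
  points form a countable union of the null sets of the previous lemma.\<close>

lemma AE_integral_has_vector_derivative:
  fixes f :: "real \<Rightarrow> 'a::euclidean_space"
  assumes f: "f integrable_on {a..b}"
  shows "AE t in lebesgue. a < t \<and> t < b \<longrightarrow>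
    ((\<lambda>x. integral {a..x} f) has_vector_derivative f t) (at t)"
proof -
  define F where "F x = integral {a..x} f" for x
  define E where "E \<epsilon> = {t \<in> {a<..<b}. \<forall>d>0. \<exists>y. \<bar>y - t\<bar> < d \<and>
    norm (F y - F t - (y - t) *\<^sub>R f t) > \<epsilon> * \<bar>y - t\<bar>}" for \<epsilon> :: real
  have "negligible (E \<epsilon>)" if "\<epsilon> > 0" for \<epsilon>
    unfolding E_def F_def by (rule negligible_integral_not_approximable[OF f that])
  then have "negligible (\<Union>n. E (inverse (real (Suc n))))"
    by (intro negligible_countable_Union) auto
  moreover have "(F has_vector_derivative f t) (at t)"
    if t: "a < t" "t < b" "t \<notin> (\<Union>n. E (inverse (real (Suc n))))" for t
    unfolding has_vector_derivative_def has_derivative_at_alt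
  proof (intro conjI allI impI)
    show "bounded_linear (\<lambda>x. x *\<^sub>R f t)" by (rule bounded_linear_scaleR_left)
    fix e :: real assume "e > 0"
    then obtain n where n: "inverse (real (Suc n)) < e" using reals_Archimedean by blast
    have "t \<notin> E (inverse (real (Suc n)))" using t by blast
    then have "\<not> (\<forall>d>0. \<exists>y. \<bar>y - t\<bar> < d \<and>
        norm (F y - F t - (y - t) *\<^sub>R f t) > inverse (real (Suc n)) * \<bar>y - t\<bar>)"
      using t(1,2) unfolding E_def by simp
    then obtain d where "d > 0" and
      d: "\<forall>y. \<not> (\<bar>y - t\<bar> < d \<and> norm (F y - F t - (y - t) *\<^sub>R f t) > inverse (real (Suc n)) * \<bar>y - t\<bar>)"
      by blast
    show "\<exists>d>0. \<forall>y. norm (y - t) < d \<longrightarrow> norm (F y - F t - (y - t) *\<^sub>R f t) \<le> e * norm (y - t)"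
    proof (intro exI[of _ d] conjI allI impI \<open>d > 0\<close>)
      fix y assume "norm (y - t) < d"
      then have "norm (F y - F t - (y - t) *\<^sub>R f t) \<le> inverse (real (Suc n)) * \<bar>y - t\<bar>"
        using d[rule_format, of y] by simp
      also have "\<dots> \<le> e * \<bar>y - t\<bar>" using n by (intro mult_right_mono) auto
      finally show "norm (F y - F t - (y - t) *\<^sub>R f t) \<le> e * norm (y - t)" by simp
    qed
  qed
  ultimately show ?thesis
    unfolding eventually_ae_filter_negligible F_def by blast
qed


section \<open>Comparison functions\<close>

lemma class_KI:
  assumes "continuous_on {0..} \<alpha>" "strict_mono_on {0..} \<alpha>" "\<alpha> 0 = 0"
  shows "\<alpha> \<in> class_K"
proof -
  have "\<alpha> s \<ge> 0" if "s \<ge> 0" for s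
    using strict_mono_onD[OF assms(2), of 0 s] that assms(3) by (cases "s = 0") auto
  then show ?thesis using assms by (auto simp: class_K_def)
qed

lemma class_K_infI:
  assumes "\<alpha> \<in> class_K" "\<And>r. \<exists>s\<ge>0. r \<le> \<alpha> s"
  shows "\<alpha> \<in> class_K_inf"
proof -
  have "\<not> bounded (\<alpha> ` {0..})"
  proof
    assume "bounded (\<alpha> ` {0..})"
    then obtain M where M: "\<And>s. s \<ge> 0 \<Longrightarrow> \<bar>\<alpha> s\<bar> \<le> M"
      by (auto simp: bounded_iff)
    obtain s where "s \<ge> 0" "M + 1 \<le> \<alpha> s" using assms(2) by blast
    with M[of s] show False by auto
  qed
  with assms(1) show ?thesis by (auto simp: class_K_inf_def)
qed

lemma class_KD:
  assumes "\<alpha> \<in> class_K"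
  shows "continuous_on {0..} \<alpha>" "\<alpha> 0 = 0"
    "\<And>s. s \<ge> 0 \<Longrightarrow> \<alpha> s \<ge> 0" "\<And>s. s > 0 \<Longrightarrow> \<alpha> s > 0"
    "\<And>s t. 0 \<le> s \<Longrightarrow> s < t \<Longrightarrow> \<alpha> s < \<alpha> t" "\<And>s t. 0 \<le> s \<Longrightarrow> s \<le> t \<Longrightarrow> \<alpha> s \<le> \<alpha> t"
proof -
  show *: "\<alpha> s < \<alpha> t" if "0 \<le> s" "s < t" for s t
    using assms that by (auto simp: class_K_def strict_mono_on_def)
  show "\<alpha> s \<le> \<alpha> t" if "0 \<le> s" "s \<le> t" for s t
    using *[of s t] that by (cases "s = t") auto
  show 0: "\<alpha> 0 = 0" "continuous_on {0..} \<alpha>" "\<And>s. s \<ge> 0 \<Longrightarrow> \<alpha> s \<ge> 0"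
    using assms by (auto simp: class_K_def)
  show "\<alpha> s > 0" if "s > 0" for s
    using *[of 0 s] 0 that by simp
qed

lemma class_K_inf_imp_class_K: "\<alpha> \<in> class_K_inf \<Longrightarrow> \<alpha> \<in> class_K"
  by (simp add: class_K_inf_def)

lemma class_K_inf_unbounded:
  assumes "\<alpha> \<in> class_K_inf"
  shows "\<exists>s\<ge>0. r \<le> \<alpha> s"
proof (rule ccontr)
  assume "\<not> ?thesis"
  then have "\<alpha> s < r" if "s \<ge> 0" for s using that by (meson not_le)
  moreover have "\<alpha> s \<ge> 0" if "s \<ge> 0" for s
    using that by (rule class_KD(3)[OF class_K_inf_imp_class_K[OF assms]])
  ultimately have "\<forall>x\<in>\<alpha> ` {0..}. norm x \<le> r" by (auto intro: less_imp_le)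
  then show False using assms by (auto simp: class_K_inf_def bounded_iff)
qed

lemma class_K_compose:
  assumes "\<alpha> \<in> class_K" "\<alpha>' \<in> class_K"
  shows "(\<lambda>s. \<alpha> (\<alpha>' s)) \<in> class_K"
proof (rule class_KI)
  show "continuous_on {0..} (\<lambda>s. \<alpha> (\<alpha>' s))"
    using assms by (intro continuous_on_compose2[OF class_KD(1)[OF assms(1)] class_KD(1)[OF assms(2)]])
      (auto simp: class_KD)
  show "strict_mono_on {0..} (\<lambda>s. \<alpha> (\<alpha>' s))"
    by (auto intro!: strict_mono_onI class_KD(3,5)[OF assms(1)] class_KD(3,5)[OF assms(2)])
qed (simp add: class_KD[OF assms(1)] class_KD[OF assms(2)])

lemma class_K_inf_compose:
  assumes "\<alpha> \<in> class_K_inf" "\<alpha>' \<in> class_K_inf"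
  shows "(\<lambda>s. \<alpha> (\<alpha>' s)) \<in> class_K_inf"
proof (rule class_K_infI)
  note K = assms[THEN class_K_inf_imp_class_K]
  show "(\<lambda>s. \<alpha> (\<alpha>' s)) \<in> class_K" using K by (rule class_K_compose)
  fix r
  obtain s where s: "s \<ge> 0" "r \<le> \<alpha> s" using class_K_inf_unbounded[OF assms(1)] by blast
  obtain u where "u \<ge> 0" "s \<le> \<alpha>' u" using class_K_inf_unbounded[OF assms(2)] by blast
  then show "\<exists>u\<ge>0. r \<le> \<alpha> (\<alpha>' u)"
    using class_KD(6)[OF K(1) s(1)] s(2) by (meson order.trans)
qed

lemma class_K_inf_linear: "c > 0 \<Longrightarrow> (\<lambda>s. c * s) \<in> class_K_inf"
proof (rule class_K_infI[OF class_KI])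
  assume c: "c > 0"
  show "\<exists>s\<ge>0. r \<le> c * s" for r
    using c by (intro exI[of _ "max 0 (r / c)"]) (auto simp: max_def field_simps)
qed (auto intro!: strict_mono_onI continuous_intros)

lemma class_K_inf_inverse:
  assumes \<alpha>: "\<alpha> \<in> class_K_inf"
  obtains \<alpha>' where "\<alpha>' \<in> class_K_inf" "\<And>s. s \<ge> 0 \<Longrightarrow> \<alpha>' (\<alpha> s) = s" "\<And>s. s \<ge> 0 \<Longrightarrow> \<alpha> (\<alpha>' s) = s"
proof -
  note K = class_KD[OF class_K_inf_imp_class_K[OF \<alpha>]]
  \<comment> \<open>Extended by the identity on the negative axis, the function becomes a strictly
    increasing bijection of the whole line, so inversion needs no care at 0.\<close>
  define a where "a s = (if s < 0 then s else \<alpha> s)" for s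
  have a_mono: "a s < a t" if "s < t" for s t
    using that K(3)[of t] K(5)[of s t] by (auto simp: a_def)
  have inj: "inj a"
    by (intro strict_mono_imp_inj_on strict_monoI a_mono)
  have surj: "\<exists>s. a s = r" for r
  proof (cases "r < 0")
    case True
    then show ?thesis by (intro exI[of _ r]) (simp add: a_def)
  next
    case False
    obtain u where u: "u \<ge> 0" "r \<le> \<alpha> u" using class_K_inf_unbounded[OF \<alpha>, of r] by blast
    have "\<exists>s\<ge>0. s \<le> u \<and> \<alpha> s = r"
      using u False K(2) by (intro IVT') (auto intro: continuous_on_subset[OF K(1)])
    then obtain s where "s \<ge> 0" "\<alpha> s = r" by blast
    then show ?thesis by (intro exI[of _ s]) (simp add: a_def)
  qed
  define b where "b = inv a"
  have ba: "b (a r) = r" for r using inj by (simp add: b_def)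
  have "surj a" using someI_ex[OF surj] by (rule surjI)
  then have ab: "a (b r) = r" for r by (simp add: b_def surj_f_inv_f)
  have b_mono: "b s < b t \<longleftrightarrow> s < t" for s t
  proof (cases "b s" "b t" rule: linorder_cases)
    case less
    then show ?thesis using a_mono[OF less] by (simp add: ab)
  next
    case equal
    have "s = t" using arg_cong[OF equal, of a] unfolding ab .
    then show ?thesis by simp
  next
    case greater
    then show ?thesis using a_mono[OF greater] by (simp add: ab)
  qed
  have "range b = UNIV" using ba by (rule surjI)
  \<comment> \<open>A monotone function onto the line has no jumps, because a jump would leave a gap
    in the range.\<close>
  then have b_cont: "continuous_on UNIV b"
    by (intro continuous_onI_mono) (auto simp: le_less b_mono)
  have b0: "b 0 = 0" using ba[of 0] K(2) by (simp add: a_def)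
  have b_nn: "b s \<ge> 0" if "s \<ge> 0" for s
    using b_mono[of s 0] that b0 by linarith
  show ?thesis
  proof
    show b\<alpha>: "b (\<alpha> s) = s" if "s \<ge> 0" for s using ba[of s] that by (simp add: a_def)
    show \<alpha>b: "\<alpha> (b s) = s" if "s \<ge> 0" for s using ab[of s] b_nn[OF that] by (simp add: a_def)
    show "b \<in> class_K_inf"
    proof (rule class_K_infI[OF class_KI])
      show "continuous_on {0..} b" using b_cont by (rule continuous_on_subset) simp
      show "strict_mono_on {0..} b" by (auto intro!: strict_mono_onI simp: b_mono)
      show "b 0 = 0" by (rule b0)
      show "\<exists>s\<ge>0. r \<le> b s" for r
        using b\<alpha>[of "max r 0"] K(3)[of "max r 0"] by (intro exI[of _ "\<alpha> (max r 0)"]) auto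
    qed
  qed
qed

text \<open>Averaging \<open>h\<close> over \<open>{s..2 * s}\<close> smooths its jumps while, by
  monotonicity, staying between \<open>h s\<close> and \<open>h (2 * s)\<close>. Adding
  \<open>s\<close> makes the average strictly increasing and unbounded.\<close>

lemma mono_dominated_by_class_K_inf:
  fixes h :: "real \<Rightarrow> real"
  assumes mono: "\<And>s t. 0 \<le> s \<Longrightarrow> s \<le> t \<Longrightarrow> h s \<le> h t" and h0: "h 0 = 0"
    and lim: "\<And>e. e > 0 \<Longrightarrow> \<exists>d>0. h d \<le> e"
  obtains \<kappa> where "\<kappa> \<in> class_K_inf" "\<And>s. s \<ge> 0 \<Longrightarrow> h s \<le> \<kappa> s"
proof -
  define A where "A s = integral {1..2} (\<lambda>\<tau>. h (s * \<tau>))" for s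
  have int: "(\<lambda>\<tau>. h (s * \<tau>)) integrable_on {1..2}" if "s \<ge> 0" for s
    using that by (intro integrable_on_mono_on mono_onI mono mult_left_mono mult_nonneg_nonneg) auto
  have A_mono: "A s \<le> A t" if "0 \<le> s" "s \<le> t" for s t
    unfolding A_def using that
    by (intro integral_le int mono mult_right_mono mult_nonneg_nonneg) auto
  have A_lower: "h s \<le> A s" if "0 \<le> s" for s
  proof -
    have "integral {1..2} (\<lambda>\<tau>::real. h s) \<le> A s"
      unfolding A_def using that by (intro integral_le int mono) (auto simp: mult_le_cancel_left1)
    then show ?thesis by simp
  qed
  have A_upper: "A s \<le> h (2 * s)" if "0 \<le> s" for s
  proof -
    have "A s \<le> integral {1..2} (\<lambda>\<tau>::real. h (2 * s))"
      unfolding A_def using that by (intro integral_le int mono) (auto simp: mult.commute[of 2] mult_left_mono)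
    then show ?thesis by simp
  qed
  have A0: "A 0 = 0" by (simp add: A_def h0)
  have A_nn: "A s \<ge> 0" if "s \<ge> 0" for s using A_mono[of 0 s] that A0 by simp
  have hint: "h integrable_on {u..v}" if "0 \<le> u" for u v
    using that by (intro integrable_on_mono_on mono_onI mono) auto
  \<comment> \<open>Rescaling turns the average into a quotient of indefinite integrals, which are
    continuous even where \<open>h\<close> jumps.\<close>
  have A_eq: "A s = (integral {0..2 * s} h - integral {0..s} h) / s" if "s > 0" for s
  proof -
    have "((\<lambda>\<tau>. h (s * \<tau>)) has_integral (1 / \<bar>s\<bar>) * integral {s..2 * s} h) ((\<lambda>x. x / s) ` {s..2 * s})"
      using has_integral_stretch_real[OF integrable_integral[OF hint[of s "2 * s"]], of s] that by auto
    moreover have "(\<lambda>x. x / s) ` {s..2 * s} = {1..2}"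
    proof (intro equalityI subsetI)
      fix x assume "x \<in> {1..2::real}"
      then have "s * x \<in> {s..2 * s}" "x = s * x / s"
        using that mult_left_mono[of x 2 s] by (auto simp: mult_le_cancel_left1 mult.commute)
      then show "x \<in> (\<lambda>x. x / s) ` {s..2 * s}" by blast
    qed (use that in \<open>auto simp: field_simps\<close>)
    ultimately have "A s = integral {s..2 * s} h / s"
      using that by (simp add: A_def integral_unique)
    also have "integral {s..2 * s} h = integral {0..2 * s} h - integral {0..s} h"
      using Henstock_Kurzweil_Integration.integral_combine[of 0 s "2 * s" h] that hint[of 0 "2 * s"] by simp
    finally show ?thesis .
  qed
  have A_cont: "continuous_on {0..} A"
    unfolding continuous_on_eq_continuous_within
  proof
    fix s :: real assume "s \<in> {0..}"
    show "continuous (at s within {0..}) A"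
    proof (cases "s = 0")
      case True
      \<comment> \<open>The quotient formula says nothing at 0; there continuity comes from
        \<open>A x \<le> h (2 * x)\<close> and the smallness assumption \<open>lim\<close>.\<close>
      show ?thesis
        unfolding True continuous_within_eps_delta
      proof (intro allI impI)
        fix e :: real assume "e > 0"
        then obtain d where d: "d > 0" "h d \<le> e / 2" using lim[of "e / 2"] by auto
        show "\<exists>d>0. \<forall>x'\<in>{0..}. dist x' 0 < d \<longrightarrow> dist (A x') (A 0) < e"
        proof (intro exI[of _ "d / 2"] conjI ballI impI)
          fix x :: real assume x: "x \<in> {0..}" "dist x 0 < d / 2"
          have "A x \<le> h (2 * x)" using x by (intro A_upper) auto
          also have "\<dots> \<le> h d" using x by (intro mono) auto
          finally show "dist (A x) (A 0) < e"
            using d(2) \<open>e > 0\<close> A0 A_nn[of x] x by auto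
        qed (use d in simp)
      qed
    next
      case False
      with \<open>s \<in> {0..}\<close> have "s > 0" by simp
      have F: "continuous_on {0..2 * (s + 1)} (\<lambda>x. integral {0..x} h)"
        by (intro indefinite_integral_continuous_1 hint) simp
      have "continuous_on {0<..<s + 1} (\<lambda>s. (integral {0..2 * s} h - integral {0..s} h) / s)"
        by (intro continuous_intros continuous_on_compose2[OF F]) auto
      then have "continuous_on {0<..<s + 1} A"
        by (rule continuous_on_eq) (simp add: A_eq)
      then have "isCont A s"
        using \<open>s > 0\<close> by (simp add: continuous_on_eq_continuous_at)
      then show ?thesis by (rule continuous_at_imp_continuous_at_within)
    qed
  qed
  show ?thesis
  proof
    show "(\<lambda>s. s + A s) \<in> class_K_inf"
    proof (rule class_K_infI[OF class_KI])
      show "continuous_on {0..} (\<lambda>s. s + A s)" by (intro continuous_intros A_cont)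
      show "strict_mono_on {0..} (\<lambda>s. s + A s)"
        using A_mono by (auto intro!: strict_mono_onI add_less_le_mono)
      show "\<exists>s\<ge>0. r \<le> s + A s" for r
        using A_nn[of "max r 0"] by (intro exI[of _ "max r 0"]) auto
    qed (simp add: A0)
    show "h s \<le> s + A s" if "s \<ge> 0" for s using A_lower[OF that] that by simp
  qed
qed

section \<open>Mutual domination of size functions\<close>

lemma size_function_nonneg:
  "size_function X xbar p \<Longrightarrow> x \<in> X \<Longrightarrow> 0 \<le> p x"
  by (cases "x = xbar") (auto simp: size_function_def less_imp_le)

text \<open>The best bound \<open>h s\<close> is the supremum of \<open>p\<close> over a sublevel
  set of \<open>q\<close>, finite because that set is compact. It is small for small
  \<open>s\<close>: the points with \<open>q \<le> 1\<close> and \<open>p \<ge> e\<close> form a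
  compact set avoiding \<open>xbar\<close>, on which \<open>q\<close> has a positive
  minimum.\<close>

lemma size_function_comparison:
  assumes p: "size_function X xbar p" and q: "size_function X xbar q" and "xbar \<in> X"
  obtains \<kappa> where "\<kappa> \<in> class_K_inf" "\<And>x. x \<in> X \<Longrightarrow> p x \<le> \<kappa> (q x)"
proof -
  define h where "h s = (SUP x\<in>{x \<in> X. q x \<le> s}. p x)" for s
  have cont: "continuous_on X p" "continuous_on X q" and q0: "q xbar = 0" and p0: "p xbar = 0"
    using p q by (auto simp: size_function_def)
  have cpt: "compact {x \<in> X. q x \<le> s}" if "s \<ge> 0" for s
    using q that by (auto simp: size_function_def)
  have bdd: "bdd_above (p ` {x \<in> X. q x \<le> s})" if "s \<ge> 0" for s
    using cpt[OF that]
    by (intro bounded_imp_bdd_above compact_imp_bounded compact_continuous_image continuous_on_subset[OF cont(1)]) auto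
  have ne: "{x \<in> X. q x \<le> s} \<noteq> {}" if "s \<ge> 0" for s using that \<open>xbar \<in> X\<close> q0 by auto
  have ph: "p x \<le> h s" if "x \<in> X" "q x \<le> s" "s \<ge> 0" for x s
    unfolding h_def using that by (intro cSUP_upper bdd) auto
  have mono: "h s \<le> h t" if "0 \<le> s" "s \<le> t" for s t
    unfolding h_def using that by (intro cSUP_subset_mono ne bdd) auto
  have "q x > 0" if "x \<in> X" "x \<noteq> xbar" for x
    using q that by (auto simp: size_function_def)
  then have "{x \<in> X. q x \<le> 0} = {xbar}"
    using \<open>xbar \<in> X\<close> q0 by (auto simp flip: not_less)
  then have h0: "h 0 = 0" by (simp add: h_def p0)
  have lim: "\<exists>d>0. h d \<le> e" if "e > 0" for e
  proof -
    define S where "S = {x \<in> X. q x \<le> 1} \<inter> p -` {e..}"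
    have "closed S"
      unfolding S_def using cpt[of 1]
      by (intro continuous_closed_preimage continuous_on_subset[OF cont(1)]) (auto intro: compact_imp_closed)
    then have "compact ({x \<in> X. q x \<le> 1} \<inter> S)" using cpt[of 1] by (intro compact_Int_closed) auto
    then have S: "compact S" by (simp add: S_def)
    have "\<exists>d>0. d \<le> 1 \<and> (\<forall>x\<in>S. d < q x)"
    proof (cases "S = {}")
      case True
      then show ?thesis by (intro exI[of _ 1]) auto
    next
      case False
      have "continuous_on S q" by (rule continuous_on_subset[OF cont(2)]) (auto simp: S_def)
      from continuous_attains_inf[OF S False this] obtain y where y: "y \<in> S" "\<forall>x\<in>S. q y \<le> q x" by blast
      then have "y \<in> X" "y \<noteq> xbar" using p0 \<open>e > 0\<close> by (auto simp: S_def)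
      then have "q y > 0" using q by (auto simp: size_function_def)
      \<comment> \<open>Halving the minimum makes the inequality strict; the cap 1 keeps the
        sublevel set of \<open>d\<close> inside the one from which \<open>S\<close> was cut
        out.\<close>
      then show ?thesis using y by (intro exI[of _ "min 1 (q y / 2)"]) force
    qed
    then obtain d where d: "d > 0" "d \<le> 1" "\<And>x. x \<in> S \<Longrightarrow> d < q x" by blast
    have "h d \<le> e"
      unfolding h_def
    proof (rule cSUP_least[OF ne])
      fix x assume "x \<in> {x \<in> X. q x \<le> d}"
      then show "p x \<le> e" using d(2) d(3)[of x] by (cases "x \<in> S") (auto simp: S_def)
    qed (use d in simp)
    with d show ?thesis by blast
  qed
  from mono_dominated_by_class_K_inf[of h, OF mono h0 lim]
  obtain \<kappa> where \<kappa>: "\<kappa> \<in> class_K_inf" "\<And>s. s \<ge> 0 \<Longrightarrow> h s \<le> \<kappa> s" by blast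
  have "p x \<le> \<kappa> (q x)" if "x \<in> X" for x
    using ph[OF that order.refl] \<kappa>(2)[of "q x"] size_function_nonneg[OF q that] by simp
  with \<kappa>(1) show ?thesis by (rule that)
qed

section \<open>Bounds of class KL\<close>

text \<open>For each \<open>t\<close> the value \<open>\<beta> r t\<close> is the unique
  \<open>s \<ge> 0\<close> with \<open>s + t * \<psi> s = r\<close>. It is of class K in
  \<open>r\<close> as the inverse of such a function, and the term
  \<open>t * \<psi> s \<le> r\<close> drives it to 0 as \<open>t\<close> grows.\<close>

lemma class_KL_of_decay:
  assumes \<psi>: "\<psi> \<in> class_K"
  obtains \<beta> where "\<beta> \<in> class_KL" "\<And>r s t. 0 \<le> s \<Longrightarrow> 0 \<le> t \<Longrightarrow> s + t * \<psi> s \<le> r \<Longrightarrow> s \<le> \<beta> r t"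
proof -
  note K = class_KD[OF \<psi>]
  have \<theta>: "(\<lambda>s. s + t * \<psi> s) \<in> class_K_inf" if "t \<ge> 0" for t
  proof (rule class_K_infI[OF class_KI])
    show "continuous_on {0..} (\<lambda>s. s + t * \<psi> s)" by (intro continuous_intros K)
    show "strict_mono_on {0..} (\<lambda>s. s + t * \<psi> s)"
      using that by (auto intro!: strict_mono_onI add_less_le_mono mult_left_mono K)
    show "\<exists>s\<ge>0. r \<le> s + t * \<psi> s" for r
      using mult_nonneg_nonneg[OF that K(3)[of "max r 0"]] by (intro exI[of _ "max r 0"]) auto
  qed (simp add: K)
  have ex: "\<exists>b. b \<in> class_K_inf \<and> (\<forall>s\<ge>0. b (s + t * \<psi> s) = s) \<and> (\<forall>r\<ge>0. b r + t * \<psi> (b r) = r)" if "t \<ge> 0" for t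
    by (rule class_K_inf_inverse[OF \<theta>[OF that]]) blast
  define b where "b t = (SOME b. b \<in> class_K_inf \<and> (\<forall>s\<ge>0. b (s + t * \<psi> s) = s) \<and> (\<forall>r\<ge>0. b r + t * \<psi> (b r) = r))" for t
  have b: "b t \<in> class_K_inf" "\<And>s. s \<ge> 0 \<Longrightarrow> b t (s + t * \<psi> s) = s"
      "\<And>r. r \<ge> 0 \<Longrightarrow> b t r + t * \<psi> (b t r) = r" if "t \<ge> 0" for t
    using someI_ex[OF ex[OF that], folded b_def] by blast+
  note bK = class_KD[OF class_K_inf_imp_class_K[OF b(1)]]
  show ?thesis
  proof
    show le: "s \<le> b t r" if "0 \<le> s" "0 \<le> t" "s + t * \<psi> s \<le> r" for r s t
    proof -
      have "s = b t (s + t * \<psi> s)" using b(2)[OF that(2) that(1)] by simp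
      also have "\<dots> \<le> b t r" using that K(3)[of s] by (intro bK(6)) auto
      finally show ?thesis .
    qed
    show "(\<lambda>r t. b t r) \<in> class_KL"
      unfolding class_KL_def mem_Collect_eq
    proof (intro conjI allI impI)
      show "(\<lambda>r. b t r) \<in> class_K" if "t \<ge> 0" for t
        using class_K_inf_imp_class_K[OF b(1)[OF that]] by simp
    next
      fix r :: real assume r: "r \<ge> 0"
      show "antimono_on {0..} (\<lambda>t. b t r)"
      proof (rule monotone_onI, clarsimp)
        fix s t :: real assume st: "0 \<le> s" "s \<le> t"
        \<comment> \<open>Solving the equation for \<open>t\<close>, the value \<open>b t r\<close>
          satisfies the inequality for the smaller \<open>s\<close> with the same \<open>r\<close>,
          so \<open>le\<close> puts it below \<open>b s r\<close>.\<close>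
        have "b t r + s * \<psi> (b t r) \<le> b t r + t * \<psi> (b t r)"
          using st r by (intro add_left_mono mult_right_mono K bK) auto
        also have "\<dots> = r" using b(3)[of t r] st r by simp
        finally show "b t r \<le> b s r" using st r by (intro le bK) auto
      qed
      show "((\<lambda>t. b t r) \<longlongrightarrow> 0) at_top"
      proof (rule tendstoI)
        fix e :: real assume "e > 0"
        have "\<forall>\<^sub>F t in at_top. t > r / \<psi> e \<and> t \<ge> 0"
          by (intro eventually_conj eventually_gt_at_top eventually_ge_at_top)
        then show "\<forall>\<^sub>F t in at_top. dist (b t r) 0 < e"
        proof eventually_elim
          case (elim t)
          \<comment> \<open>A value of at least \<open>e\<close> would give
            \<open>t * \<psi> e \<le> r\<close>, which \<open>t > r / \<psi> e\<close>
            excludes.\<close>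
          have "b t r < e"
          proof (rule ccontr)
            assume "\<not> b t r < e"
            then have "t * \<psi> e \<le> t * \<psi> (b t r)" using elim \<open>e > 0\<close> by (intro mult_left_mono K) auto
            also have "\<dots> \<le> r" using b(3)[of t r] bK(3)[of t r] elim r by linarith
            also have "r < t * \<psi> e" using elim K(4)[OF \<open>e > 0\<close>] by (simp add: field_simps)
            finally show False by simp
          qed
          then show ?case using bK(3)[of t r] elim r by simp
        qed
      qed
    qed
  qed
qed

lemma class_KL_compose:
  assumes \<beta>: "\<beta> \<in> class_KL" and \<alpha>: "\<alpha> \<in> class_K" and \<alpha>': "\<alpha>' \<in> class_K"
  shows "(\<lambda>r t. \<alpha> (\<beta> (\<alpha>' r) t)) \<in> class_KL"
  unfolding class_KL_def mem_Collect_eq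
proof (intro conjI allI impI)
  have \<beta>K: "(\<lambda>r. \<beta> r t) \<in> class_K" if "t \<ge> 0" for t
    using \<beta> that by (auto simp: class_KL_def)
  show "(\<lambda>r. \<alpha> (\<beta> (\<alpha>' r) t)) \<in> class_K" if "t \<ge> 0" for t
    using class_K_compose[OF \<alpha> class_K_compose[OF \<beta>K[OF that] \<alpha>']] .
  fix r :: real assume "r \<ge> 0"
  then have r': "\<alpha>' r \<ge> 0" by (rule class_KD(3)[OF \<alpha>'])
  then have anti: "antimono_on {0..} (\<beta> (\<alpha>' r))" and lim: "(\<beta> (\<alpha>' r) \<longlongrightarrow> 0) at_top"
    using \<beta> by (auto simp: class_KL_def)
  have nn: "\<beta> (\<alpha>' r) t \<ge> 0" if "t \<ge> 0" for t using class_KD(3)[OF \<beta>K[OF that] r'] .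
  show "antimono_on {0..} (\<lambda>t. \<alpha> (\<beta> (\<alpha>' r) t))"
    using anti nn by (auto simp: monotone_on_def intro!: class_KD(6)[OF \<alpha>])
  have "((\<lambda>t. \<alpha> (\<beta> (\<alpha>' r) t)) \<longlongrightarrow> \<alpha> 0) at_top"
  proof (rule continuous_on_tendsto_compose[OF class_KD(1)[OF \<alpha>] lim])
    show "\<forall>\<^sub>F t in at_top. \<beta> (\<alpha>' r) t \<in> {0..}"
      using eventually_ge_at_top[of 0] by eventually_elim (simp add: nn)
  qed simp
  then show "((\<lambda>t. \<alpha> (\<beta> (\<alpha>' r) t)) \<longlongrightarrow> 0) at_top" by (simp add: class_KD[OF \<alpha>])
qed


section \<open>Global Caratheodory solutions\<close>

text \<open>The contraction is taken in the norm weighted by \<open>exp (- \<mu> t)\<close>, which makes it uniform in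
  time, so that a single fixed point gives the solution on the whole half line.\<close>

lemma caratheodory_global_solution:
  fixes H :: "'a::euclidean_space \<Rightarrow> 'b::euclidean_space \<Rightarrow> 'a"
  assumes lip: "K-lipschitz_on (UNIV \<times> cball 0 U) (\<lambda>(x, v). H x v)"
    and bnd: "\<And>x v. norm v \<le> U \<Longrightarrow> norm (H x v) \<le> M"
    and u: "u \<in> borel_measurable lebesgue" "\<And>t. norm (u t) \<le> U"
  obtains x where "x 0 = x0" "\<And>b. abs_continuous_on {0..b} x"
    "AE t in lebesgue. 0 < t \<longrightarrow> (x has_vector_derivative H (x t) (u t)) (at t)"
proof -
  have U: "U \<ge> 0" using u(2)[of 0] norm_ge_zero[of "u 0"] by linarith
  have M: "M \<ge> 0" using order.trans[OF norm_ge_zero bnd[of 0 0]] U by simp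
  have K: "K \<ge> 0" using lip by (rule lipschitz_on_nonneg)
  have HK: "norm (H a v - H b v) \<le> K * norm (a - b)" if "norm v \<le> U" for a b v
    using lipschitz_on_normD[OF lip, of "(a, v)" "(b, v)"] that by (simp add: norm_Pair)
  have int: "(\<lambda>t. H (z t) (u t)) integrable_on {a..b}" if z: "continuous_on UNIV z" for z a b
  proof (rule measurable_bounded_by_integrable_imp_integrable)
    \<comment> \<open>\<open>H\<close> is controlled only for inputs in the ball. Composition with
      the projection onto it gives a function continuous everywhere, for which measurability is
      available, and does not change the values along \<open>u\<close>.\<close>
    let ?c = "closest_point (cball (0::'b) U)"
    have H: "continuous_on UNIV (\<lambda>p. (\<lambda>(x, v). H x v) (fst p, ?c (snd p)))"
    proof (rule continuous_on_compose2[OF lipschitz_on_continuous_on[OF lip]])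
      show "continuous_on UNIV (\<lambda>p::'a \<times> 'b. (fst p, ?c (snd p)))"
        using U by (intro continuous_intros continuous_on_compose2[OF continuous_on_closest_point[where t = UNIV]]) auto
      show "(\<lambda>p::'a \<times> 'b. (fst p, ?c (snd p))) ` UNIV \<subseteq> UNIV \<times> cball 0 U"
        using closest_point_in_set[of "cball (0::'b) U"] U by auto
    qed
    have "z \<in> borel_measurable lebesgue"
      using borel_measurable_continuous_onI[OF z] by (intro measurable_completion) simp
    then have "(\<lambda>t. H (z t) (?c (u t))) \<in> borel_measurable lebesgue"
      by (rule borel_measurable_continuous_Pair[where H = "\<lambda>x v. H x (?c v)"]) (use u(1) H in simp_all)
    moreover have "?c (u t) = u t" for t
      using u(2) by (intro closest_point_self) auto
    ultimately show "(\<lambda>t. H (z t) (u t)) \<in> borel_measurable (lebesgue_on {a..b})"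
      by (simp add: measurable_restrict_space1)
    show "(\<lambda>t. M) integrable_on {a..b}" by (rule integrable_const_ivl)
  qed (use bnd u in auto)
  \<comment> \<open>The contraction factor will be \<open>K / \<mu>\<close>, which this choice makes
    at most 1/2.\<close>
  define \<mu> where "\<mu> = 2 * K + 1"
  have \<mu>: "\<mu> > 0" using K by (simp add: \<mu>_def)
  \<comment> \<open>The unknown \<open>y\<close> is the trajectory multiplied by
    \<open>exp (- \<mu> * t)\<close>. It stays bounded although the trajectory may grow linearly,
    and the weighted norm of the trajectory becomes the plain supremum norm of
    \<open>y\<close>.\<close>
  define G where "G y t = integral {0..t} (\<lambda>s. H (exp (\<mu> * s) *\<^sub>R y s) (u s))" for y :: "real \<Rightarrow> 'a" and t
  have Gint: "(\<lambda>s. H (exp (\<mu> * s) *\<^sub>R y s) (u s)) integrable_on {a..b}" if "continuous_on UNIV y" for y a b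
    by (intro int continuous_intros that)
  have Gdiff: "norm (G y t - G y s) \<le> M * (t - s)" if "0 \<le> s" "s \<le> t" "continuous_on UNIV y" for y s t
  proof -
    have "G y t - G y s = integral {s..t} (\<lambda>s. H (exp (\<mu> * s) *\<^sub>R y s) (u s))"
      using Henstock_Kurzweil_Integration.integral_combine[OF that(1,2) Gint[OF that(3)]]
      by (simp add: G_def algebra_simps)
    also have "norm \<dots> \<le> integral {s..t} (\<lambda>_. M)"
      by (intro integral_norm_bound_integral Gint that bnd u integrable_const_ivl)
    finally show ?thesis using that by (simp add: mult.commute)
  qed
  have Glip: "M-lipschitz_on {0..} (G y)" if "continuous_on UNIV y" for y
  proof (rule lipschitz_onI)
    fix s t :: real assume "s \<in> {0..}" "t \<in> {0..}"
    then show "dist (G y s) (G y t) \<le> M * dist s t"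
      using Gdiff[of s t y] Gdiff[of t s y] that
      by (cases "s \<le> t") (auto simp: dist_norm norm_minus_commute)
  qed (rule M)
  \<comment> \<open>Bounded continuous functions live on the whole line, so the value at time 0 is
    kept at negative times.\<close>
  define Q where "Q y t = exp (- \<mu> * max 0 t) *\<^sub>R (x0 + G y (max 0 t))" for y t
  have Q: "Q y \<in> bcontfun" if y: "continuous_on UNIV y" for y
  proof -
    have "continuous_on UNIV (\<lambda>t. G y (max 0 t))"
      by (rule continuous_on_compose2[OF lipschitz_on_continuous_on[OF Glip[OF y]]])
        (auto intro!: continuous_intros)
    then have "continuous_on UNIV (Q y)"
      unfolding Q_def by (intro continuous_intros)
    moreover have "norm (Q y t) \<le> norm x0 + M / \<mu>" for t
    proof -
      define \<tau> where "\<tau> = max 0 t"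
      have \<tau>: "\<tau> \<ge> 0" by (simp add: \<tau>_def)
      have "G y 0 = 0" by (simp add: G_def)
      then have "norm (x0 + G y \<tau>) \<le> norm x0 + M * \<tau>"
        using Gdiff[of 0 \<tau> y] y \<tau> norm_triangle_ineq[of x0 "G y \<tau>"] by simp
      then have "norm (Q y t) \<le> exp (- \<mu> * \<tau>) * (norm x0 + M * \<tau>)"
        by (simp add: Q_def \<tau>_def)
      also have "\<dots> = exp (- (\<mu> * \<tau>)) * norm x0 + M / \<mu> * (exp (- (\<mu> * \<tau>)) * (\<mu> * \<tau>))"
        using \<mu> by (simp add: field_simps)
      also have "\<dots> \<le> 1 * norm x0 + M / \<mu> * 1"
      proof (intro add_mono mult_right_mono mult_left_mono)
        have "\<mu> * \<tau> \<le> exp (\<mu> * \<tau>)" using exp_ge_add_one_self[of "\<mu> * \<tau>"] by linarith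
        then show "exp (- (\<mu> * \<tau>)) * (\<mu> * \<tau>) \<le> 1" by (simp add: exp_minus field_simps)
      qed (use \<mu> \<tau> M in auto)
      finally show ?thesis by simp
    qed
    ultimately show ?thesis unfolding bcontfun_def bounded_iff by auto
  qed
  define R where "R y = Bcontfun (Q (apply_bcontfun y))" for y :: "real \<Rightarrow>\<^sub>C 'a"
  have R: "apply_bcontfun (R y) = Q (apply_bcontfun y)" for y
    unfolding R_def by (intro Bcontfun_inverse Q) simp
  have contr: "dist (R y) (R z) \<le> 1 / 2 * dist y z" for y z
  proof (rule dist_bound)
    fix t :: real
    define \<tau> where "\<tau> = max 0 t"
    define d where "d = dist y z"
    have d: "norm (y s - z s) \<le> d" for s
      using dist_bounded[of y s z] by (simp add: d_def dist_norm)
    have \<tau>: "\<tau> \<ge> 0" by (simp add: \<tau>_def)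
    have E: "((\<lambda>s. exp (\<mu> * s)) has_integral (exp (\<mu> * \<tau>) / \<mu> - exp (\<mu> * 0) / \<mu>)) {0..\<tau>}"
      using \<mu> \<tau>
      by (intro fundamental_theorem_of_calculus)
        (auto intro!: derivative_eq_intros simp flip: has_real_derivative_iff_has_vector_derivative)
    have E': "((\<lambda>s. K * d * exp (\<mu> * s)) has_integral K * d * (exp (\<mu> * \<tau>) / \<mu> - exp (\<mu> * 0) / \<mu>)) {0..\<tau>}"
      by (rule has_integral_mult_right[OF E])
    have "norm (G y \<tau> - G z \<tau>) \<le> K * d * (exp (\<mu> * \<tau>) / \<mu> - exp (\<mu> * 0) / \<mu>)"
      unfolding G_def integral_unique[OF E', symmetric]
    proof (subst integral_diff[symmetric])
      show "norm (integral {0..\<tau>} (\<lambda>s. H (exp (\<mu> * s) *\<^sub>R y s) (u s) - H (exp (\<mu> * s) *\<^sub>R z s) (u s)))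
        \<le> integral {0..\<tau>} (\<lambda>s. K * d * exp (\<mu> * s))"
      proof (intro integral_norm_bound_integral integrable_diff Gint has_integral_integrable[OF E'])
        fix s
        have "norm (H (exp (\<mu> * s) *\<^sub>R y s) (u s) - H (exp (\<mu> * s) *\<^sub>R z s) (u s))
          \<le> K * norm (exp (\<mu> * s) *\<^sub>R y s - exp (\<mu> * s) *\<^sub>R z s)"
          by (intro HK u)
        also have "\<dots> = K * (exp (\<mu> * s) * norm (y s - z s))"
          by (simp flip: scaleR_diff_right)
        also have "\<dots> \<le> K * (exp (\<mu> * s) * d)"
          using K by (intro mult_left_mono d) auto
        finally show "norm (H (exp (\<mu> * s) *\<^sub>R y s) (u s) - H (exp (\<mu> * s) *\<^sub>R z s) (u s)) \<le> K * d * exp (\<mu> * s)"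
          by (simp add: mult_ac)
      qed auto
    qed (auto intro!: Gint)
    then have "norm (Q y t - Q z t) \<le> exp (- (\<mu> * \<tau>)) * (K * d * (exp (\<mu> * \<tau>) / \<mu> - exp (\<mu> * 0) / \<mu>))"
      by (simp add: Q_def \<tau>_def flip: scaleR_diff_right)
    also have "\<dots> \<le> exp (- (\<mu> * \<tau>)) * (K * d * (exp (\<mu> * \<tau>) / \<mu>))"
      using K \<mu> by (intro mult_left_mono) (auto simp: d_def)
    also have "\<dots> = (K / \<mu>) * d" by (simp add: exp_minus)
    also have "\<dots> \<le> 1 / 2 * d"
      using K by (intro mult_right_mono) (auto simp: d_def \<mu>_def field_simps)
    finally show "dist (R y t) (R z t) \<le> 1 / 2 * dist y z" by (simp add: R dist_norm d_def)
  qed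
  have "\<exists>!y. R y = y" using contr by (intro banach_fix_type[of "1 / 2"]) auto
  then obtain y where y: "R y = y" by blast
  define x where "x t = exp (\<mu> * t) *\<^sub>R y t" for t
  have xG: "x t = x0 + G y t" if "t \<ge> 0" for t
  proof -
    have "y t = Q y t" using R[of y] y by simp
    then show ?thesis using that by (simp add: x_def Q_def exp_minus)
  qed
  have G: "G y t = integral {0..t} (\<lambda>s. H (x s) (u s))" for t by (simp add: G_def x_def)
  have xint: "(\<lambda>s. H (x s) (u s)) integrable_on {a..b}" for a b
    using Gint[of y] by (simp add: x_def)
  show ?thesis
  proof
    show "x 0 = x0" using xG[of 0] by (simp add: G_def)
    show "abs_continuous_on {0..b} x" for b
    proof (rule lipschitz_imp_abs_continuous_on[of M])
      have "M-lipschitz_on {0..b} (G y)" by (rule lipschitz_on_subset[OF Glip]) auto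
      then show "M-lipschitz_on {0..b} x" by (simp add: lipschitz_on_def xG)
    qed
    \<comment> \<open>Differentiation of the integral is known on bounded intervals; countably many
      of them exhaust the half line.\<close>
    have "AE t in lebesgue. 0 < t \<and> t < real n \<longrightarrow> (G y has_vector_derivative H (x t) (u t)) (at t)" for n
      using AE_integral_has_vector_derivative[OF xint, of 0 "real n"] by (simp flip: G)
    then have "AE t in lebesgue. \<forall>n. 0 < t \<and> t < real n \<longrightarrow> (G y has_vector_derivative H (x t) (u t)) (at t)"
      unfolding AE_all_countable by blast
    then show "AE t in lebesgue. 0 < t \<longrightarrow> (x has_vector_derivative H (x t) (u t)) (at t)"
    proof eventually_elim
      case (elim t)
      show ?case
      proof
        assume t: "0 < t"
        obtain n where "t < real n" using reals_Archimedean2 by blast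
        with elim t have "(G y has_vector_derivative H (x t) (u t)) (at t)" by blast
        then have "((\<lambda>t. x0 + G y t) has_vector_derivative H (x t) (u t)) (at t)"
          by (auto intro!: derivative_eq_intros)
        then show "(x has_vector_derivative H (x t) (u t)) (at t)"
          by (rule has_vector_derivative_transform_within_open[of _ _ _ "{0<..}"]) (use t xG in auto)
      qed
    qed
  qed
qed


section \<open>Input to state stability of the perturbed gradient flow\<close>

text \<open>On \<open>{0..t}\<close> the function stays at or above \<open>y t\<close>: to come up
  to \<open>y t\<close> from a lower value it would have to rise while above \<open>L\<close>. Hence
  its rate of decrease is at least the constant \<open>\<psi> (y t)\<close> at almost every time,
  and the increment bound applies.\<close>

lemma abs_continuous_decay:
  fixes y :: "real \<Rightarrow> real"
  assumes "t \<ge> 0" and ac: "abs_continuous_on {0..t} y"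
    and ae: "AE \<tau> in lebesgue. 0 < \<tau> \<and> \<tau> < t \<longrightarrow> L < y \<tau> \<longrightarrow>
      (\<exists>D\<le>- \<psi> (y \<tau>). (y has_real_derivative D) (at \<tau>))"
    and nonneg: "\<And>a. L < a \<Longrightarrow> 0 \<le> \<psi> a"
    and mono: "\<And>a b. L < a \<Longrightarrow> a \<le> b \<Longrightarrow> \<psi> a \<le> \<psi> b"
    and above: "L < y t"
  shows "y t + t * \<psi> (y t) \<le> y 0"
proof -
  have cont: "continuous_on {0..t} y" using ac by (rule abs_continuous_on_imp_continuous_on)
  have ge: "y t \<le> y \<tau>" if \<tau>: "0 \<le> \<tau>" "\<tau> \<le> t" for \<tau>
  proof (rule ccontr)
    assume "\<not> y t \<le> y \<tau>"
    \<comment> \<open>After the last time with \<open>y \<le> m\<close> the function exceeds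
      \<open>L\<close>, so it does not increase and cannot reach \<open>y t > m\<close>.\<close>
    define m where "m = max (y \<tau>) L"
    have m: "m < y t" using \<open>\<not> y t \<le> y \<tau>\<close> above by (simp add: m_def)
    define S where "S = {\<tau>..t} \<inter> y -` {..m}"
    have "closed S"
      unfolding S_def using \<tau> by (intro continuous_closed_preimage continuous_on_subset[OF cont]) auto
    then have "compact ({\<tau>..t} \<inter> S)" by (intro compact_Int_closed) auto
    then have "compact S" by (simp add: S_def)
    moreover have "\<tau> \<in> S" using \<tau> by (simp add: S_def m_def)
    ultimately obtain \<sigma> where \<sigma>: "\<sigma> \<in> S" "\<And>s. s \<in> S \<Longrightarrow> s \<le> \<sigma>"
      using compact_attains_sup[of S] by blast
    have "\<sigma> \<le> t" "0 \<le> \<sigma>" "y \<sigma> \<le> m" using \<sigma>(1) \<tau> by (auto simp: S_def)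
    have "y t - y \<sigma> \<le> 0 * (t - \<sigma>)"
    proof (rule abs_continuous_on_increment_le)
      show "abs_continuous_on {\<sigma>..t} y"
        by (rule abs_continuous_on_subset[OF ac]) (use \<open>0 \<le> \<sigma>\<close> in auto)
      show "AE s in lebesgue. \<sigma> < s \<and> s < t \<longrightarrow> (\<exists>D\<le>0. (y has_real_derivative D) (at s))"
        using ae
      proof eventually_elim
        case (elim s)
        show ?case
        proof
          assume s: "\<sigma> < s \<and> s < t"
          then have "s \<notin> S" using \<sigma>(2)[of s] by auto
          then have "L < y s" using s \<sigma>(1) by (auto simp: S_def m_def)
          with elim s \<open>0 \<le> \<sigma>\<close> obtain D where "D \<le> - \<psi> (y s)" "(y has_real_derivative D) (at s)" by auto
          moreover have "0 \<le> \<psi> (y s)" using \<open>L < y s\<close> by (rule nonneg)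
          ultimately show "\<exists>D\<le>0. (y has_real_derivative D) (at s)" by (intro exI[of _ D]) auto
        qed
      qed
    qed fact
    then show False using m \<open>y \<sigma> \<le> m\<close> by simp
  qed
  have "y t - y 0 \<le> - \<psi> (y t) * (t - 0)"
  proof (rule abs_continuous_on_increment_le[OF \<open>t \<ge> 0\<close> ac])
    show "AE s in lebesgue. 0 < s \<and> s < t \<longrightarrow> (\<exists>D\<le>- \<psi> (y t). (y has_real_derivative D) (at s))"
      using ae
    proof eventually_elim
      case (elim s)
      show ?case
      proof
        assume s: "0 < s \<and> s < t"
        then have "y t \<le> y s" using ge by simp
        with elim s above obtain D where "D \<le> - \<psi> (y s)" "(y has_real_derivative D) (at s)" by auto
        moreover have "\<psi> (y t) \<le> \<psi> (y s)" using above \<open>y t \<le> y s\<close> by (rule mono)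
        ultimately show "\<exists>D\<le>- \<psi> (y t). (y has_real_derivative D) (at s)" by (intro exI[of _ D]) auto
      qed
    qed
  qed
  then show ?thesis by (simp add: algebra_simps)
qed

lemma input_norm_bound:
  fixes u :: "real \<Rightarrow> 'b::euclidean_space"
  assumes "is_input u"
  shows "AE t in lebesgue. 0 \<le> t \<longrightarrow> norm (u t) \<le> input_norm u" and "0 \<le> input_norm u"
proof -
  have ae0: "AE t in lebesgue. 0 \<le> t \<longrightarrow> ereal (norm (u t)) \<le> ess_norm u"
    using esssup_AE[of "\<lambda>t. ereal (norm (u t))" "lebesgue_on {0..}"]
    by (subst (asm) AE_restrict_space_iff) (auto simp: ess_norm_def)
  \<comment> \<open>The half line is not a null set, so the essential bound holds at some point of
    it. This excludes the value minus infinity, and conversion to a real number is then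
    faithful.\<close>
  have "\<not> (AE t in lebesgue. \<not> (0::real) \<le> t)"
  proof
    assume "AE t in lebesgue. \<not> (0::real) \<le> t"
    then obtain N :: "real set" where "negligible N" "{t. \<not> \<not> 0 \<le> t} \<subseteq> N"
      unfolding eventually_ae_filter_negligible by blast
    then have "negligible {0..1::real}" by (elim negligible_subset) auto
    then show False using negligible_interval(1)[of "0::real" 1] by simp
  qed
  then have "\<exists>t\<ge>0. ereal (norm (u t)) \<le> ess_norm u"
    using ae0 by (metis (mono_tags, lifting) eventually_mono)
  then obtain t where "ereal (norm (u t)) \<le> ess_norm u" by blast
  moreover have "ess_norm u < \<infinity>" using assms by (simp add: is_input_def)
  ultimately obtain r where r: "ess_norm u = ereal r" "norm (u t) \<le> r"
    by (cases "ess_norm u") auto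
  have U: "input_norm u = r" by (simp add: input_norm_def r)
  show "0 \<le> input_norm u" using r(2) norm_ge_zero[of "u t"] unfolding U by linarith
  show "AE t in lebesgue. 0 \<le> t \<longrightarrow> norm (u t) \<le> input_norm u"
    using ae0 by (simp add: U r)
qed

section \<open>Lipschitz estimates and the cut-off\<close>

lemma locally_lipschitz_on_imp_lipschitz_on_compact:
  assumes "locally_lipschitz_on S f" "compact T" "T \<subseteq> S"
  obtains L where "L-lipschitz_on T f"
proof -
  have "local_lipschitz {0::real} T (\<lambda>_. f)"
    using local_lipschitz_subset[OF assms(1)[unfolded locally_lipschitz_on_def] subset_UNIV assms(3)] .
  from local_lipschitz_compact_implies_lipschitz[OF this assms(2), of thesis]
  show ?thesis using that by auto
qed

text \<open>A closed ball inside \<open>X\<close> is compact, which bounds the gradient, and convex,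
  which allows the mean value inequality.\<close>

lemma continuous_gradient_imp_locally_lipschitz_on:
  fixes V :: "'a::euclidean_space \<Rightarrow> real"
  assumes "open X" and diff: "\<And>x. x \<in> X \<Longrightarrow> V differentiable (at x)"
    and cont: "continuous_on X (gradient V)"
  shows "locally_lipschitz_on X V"
  unfolding locally_lipschitz_on_def
proof (rule local_lipschitzI)
  fix t :: real and x assume "x \<in> X"
  then obtain r where r: "r > 0" "cball x r \<subseteq> X"
    using \<open>open X\<close> open_contains_cball by blast
  have "compact (gradient V ` cball x r)"
    by (intro compact_continuous_image continuous_on_subset[OF cont r(2)]) auto
  then obtain C where C: "C > 0" "\<And>y. y \<in> cball x r \<Longrightarrow> norm (gradient V y) \<le> C"
    by (auto dest!: compact_imp_bounded simp: bounded_pos)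
  have "C-lipschitz_on (cball x r) V"
  proof (rule bounded_derivative_imp_lipschitz)
    fix y assume y: "y \<in> cball x r"
    show "(V has_derivative (\<lambda>h. h \<bullet> gradient V y)) (at y within cball x r)"
      using GDERIV_gradient[OF diff[OF subsetD[OF r(2) y]]]
      unfolding gderiv_def by (rule has_derivative_at_withinI)
    show "onorm (\<lambda>h. h \<bullet> gradient V y) \<le> C"
    proof (rule onorm_bound)
      fix h
      have "norm (h \<bullet> gradient V y) \<le> norm h * norm (gradient V y)" by (rule Cauchy_Schwarz_ineq2[folded real_norm_def])
      also have "\<dots> \<le> norm h * C" by (intro mult_left_mono C y) auto
      finally show "norm (h \<bullet> gradient V y) \<le> C * norm h" by (simp add: mult.commute)
    qed (use C in simp)
  qed (use C in auto)
  then have "C-lipschitz_on (cball x r \<inter> X) V" by (rule lipschitz_on_subset) auto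
  then show "\<exists>u>0. \<exists>L. \<forall>t\<in>cball t u \<inter> UNIV. L-lipschitz_on (cball x u \<inter> X) V"
    using r(1) by blast
qed

text \<open>The factor \<open>\<zeta>\<close> falls linearly from 1 on \<open>C\<close> to 0 at
  distance \<open>d\<close>, inside a compact \<open>C'\<close> contained in \<open>X\<close>.
  Between two points of \<open>C'\<close> the product rule gives the Lipschitz bound; if one point
  is outside \<open>C'\<close>, the product vanishes there and the slope of \<open>\<zeta>\<close>
  controls its value at the other.\<close>

lemma cutoff_lipschitz:
  fixes f :: "'a::euclidean_space \<Rightarrow> 'b::euclidean_space \<Rightarrow> 'c::euclidean_space"
  assumes f: "locally_lipschitz_on (X \<times> UNIV) (\<lambda>(x, v). f x v)"
    and "open X" "compact C" "C \<noteq> {}" "C \<subseteq> X" and U: "U \<ge> 0"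
  obtains \<zeta> K M where "\<And>x. 0 \<le> \<zeta> x" "\<And>x. \<zeta> x \<le> 1" "\<And>x. x \<in> C \<Longrightarrow> \<zeta> x = 1"
    "K-lipschitz_on (UNIV \<times> cball 0 U) (\<lambda>(x, v). \<zeta> x *\<^sub>R f x v)"
    "\<And>x v. norm v \<le> U \<Longrightarrow> norm (\<zeta> x *\<^sub>R f x v) \<le> M"
proof -
  obtain d where d: "d > 0" "{x. infdist x C \<le> d} \<subseteq> X"
    using compact_in_open_separated[OF \<open>C \<noteq> {}\<close> \<open>compact C\<close> \<open>open X\<close> \<open>C \<subseteq> X\<close>] by blast
  define C' where "C' = {x. infdist x C \<le> d}"
  have C': "compact C'" "C' \<subseteq> X"
    using compact_infdist_le[OF \<open>C \<noteq> {}\<close> \<open>compact C\<close> d(1)] d(2) by (auto simp: C'_def)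
  define \<zeta> where "\<zeta> x = max 0 (1 - infdist x C / d)" for x
  have \<zeta>0: "\<zeta> x = 0" if "x \<notin> C'" for x using that d(1) by (simp add: \<zeta>_def C'_def)
  have \<zeta>01: "0 \<le> \<zeta> x" "\<zeta> x \<le> 1" for x using d(1) infdist_nonneg[of x C] by (auto simp: \<zeta>_def)
  have \<zeta>lip: "\<bar>\<zeta> x - \<zeta> y\<bar> \<le> dist x y / d" for x y
  proof -
    have "\<bar>\<zeta> x - \<zeta> y\<bar> \<le> \<bar>infdist x C / d - infdist y C / d\<bar>" by (simp add: \<zeta>_def max_def abs_if)
    also have "\<dots> = \<bar>infdist x C - infdist y C\<bar> / d" using d(1) by (simp flip: diff_divide_distrib)
    also have "\<dots> \<le> dist x y / d" using d(1) by (intro divide_right_mono infdist_triangle_abs) auto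
    finally show ?thesis .
  qed
  have cpt: "compact (C' \<times> cball (0::'b) U)" by (intro compact_Times C' compact_cball)
  obtain L where L: "L-lipschitz_on (C' \<times> cball 0 U) (\<lambda>(x, v). f x v)"
    using locally_lipschitz_on_imp_lipschitz_on_compact[OF f cpt] C'(2) by blast
  have "compact ((\<lambda>(x, v). f x v) ` (C' \<times> cball 0 U))"
    by (intro compact_continuous_image lipschitz_on_continuous_on[OF L] cpt)
  then obtain M where M: "M > 0" "\<And>x v. x \<in> C' \<Longrightarrow> norm v \<le> U \<Longrightarrow> norm (f x v) \<le> M"
    by (force dest!: compact_imp_bounded simp: bounded_pos)
  have L0: "L \<ge> 0" using L by (rule lipschitz_on_nonneg)
  have Hle: "norm (\<zeta> x *\<^sub>R f x v) \<le> \<zeta> x * M" if "norm v \<le> U" for x v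
    using \<zeta>0[of x] \<zeta>01[of x] M(2)[of x v] that by (cases "x \<in> C'") (auto intro: mult_left_mono)
  have dist_fst: "dist x y \<le> dist (x, v) (y, w)" for x y :: 'a and v w :: 'b
    using dist_fst_le[of "(x, v)" "(y, w)"] by simp
  have half: "norm (\<zeta> x *\<^sub>R f x v - \<zeta> y *\<^sub>R f y w) \<le> (M / d + L) * dist (x, v) (y, w)"
    if vw: "norm v \<le> U" "norm w \<le> U" and y: "y \<notin> C'" for x y v w
  proof -
    have "norm (\<zeta> x *\<^sub>R f x v - \<zeta> y *\<^sub>R f y w) \<le> M * \<zeta> x"
      using Hle[OF vw(1), of x] \<zeta>0[OF y] by (simp add: mult.commute)
    also have "\<dots> \<le> M * (dist x y / d)"
      using \<zeta>lip[of x y] \<zeta>0[OF y] \<zeta>01[of x] M(1) by (intro mult_left_mono) auto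
    also have "\<dots> \<le> M * (dist (x, v) (y, w) / d)"
      using M(1) d(1) dist_fst by (intro mult_left_mono divide_right_mono) auto
    also have "\<dots> \<le> (M / d + L) * dist (x, v) (y, w)"
      using L0 by (simp add: algebra_simps)
    finally show ?thesis .
  qed
  have lip: "(M / d + L)-lipschitz_on (UNIV \<times> cball 0 U) (\<lambda>(x, v). \<zeta> x *\<^sub>R f x v)"
  proof (rule lipschitz_onI, clarsimp simp: dist_norm[of "scaleR _ _"])
    fix x y :: 'a and v w :: 'b
    assume vw: "norm v \<le> U" "norm w \<le> U"
    consider "y \<notin> C'" | "x \<notin> C'" | "x \<in> C'" "y \<in> C'" by blast
    then show "norm (\<zeta> x *\<^sub>R f x v - \<zeta> y *\<^sub>R f y w) \<le> (M / d + L) * dist (x, v) (y, w)"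
    proof cases
      case 1
      then show ?thesis using half vw by blast
    next
      case 2
      then show ?thesis using half[of w v x y] vw by (simp add: norm_minus_commute dist_commute)
    next
      case 3
      have "\<zeta> x *\<^sub>R f x v - \<zeta> y *\<^sub>R f y w = (\<zeta> x - \<zeta> y) *\<^sub>R f x v + \<zeta> y *\<^sub>R (f x v - f y w)"
        by (simp add: algebra_simps)
      also have "norm \<dots> \<le> \<bar>\<zeta> x - \<zeta> y\<bar> * norm (f x v) + \<zeta> y * norm (f x v - f y w)"
        using \<zeta>01 by (metis abs_of_nonneg norm_scaleR norm_triangle_ineq)
      also have "\<dots> \<le> dist x y / d * M + 1 * norm (f x v - f y w)"
        using \<zeta>lip \<zeta>01 M 3 vw d(1) by (intro add_mono mult_mono) auto
      also have "\<dots> \<le> dist (x, v) (y, w) / d * M + L * dist (x, v) (y, w)"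
        using lipschitz_onD[OF L, of "(x, v)" "(y, w)"] 3 vw M(1) d(1) dist_fst[of x y v w]
        by (intro add_mono mult_right_mono divide_right_mono) (auto simp: dist_norm)
      also have "\<dots> = (M / d + L) * dist (x, v) (y, w)" by (simp add: algebra_simps)
      finally show ?thesis .
    qed
  qed (use M(1) d(1) L0 in auto)
  show ?thesis
  proof (rule that[OF \<zeta>01 _ lip])
    show "\<zeta> x = 1" if "x \<in> C" for x using that by (simp add: \<zeta>_def)
    show "norm (\<zeta> x *\<^sub>R f x v) \<le> M" if "norm v \<le> U" for x v
      using order.trans[OF Hle[OF that, of x] mult_right_mono[OF \<zeta>01(2)[of x], of M]] M(1) by simp
  qed
qed

text \<open>Cauchy-Schwarz in each row; summing over the rows produces \<open>CARD('n)\<close>, a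
  dimensional constant that ends up in the gain.\<close>

lemma norm_matrix_vector_mult_le:
  fixes A :: "real ^ 'm ^ 'n"
  shows "norm (A *v v) \<le> real CARD('n) * norm A * norm v"
proof -
  have "norm (A *v v) \<le> (\<Sum>i\<in>UNIV. \<bar>(A *v v) $ i\<bar>)" by (rule norm_le_l1_cart)
  also have "\<dots> \<le> (\<Sum>i\<in>(UNIV::'n set). norm A * norm v)"
  proof (rule sum_mono)
    fix i
    have "\<bar>(A *v v) $ i\<bar> \<le> norm (A $ i) * norm v"
      unfolding matrix_vector_mul_component by (rule Cauchy_Schwarz_ineq2)
    also have "\<dots> \<le> norm A * norm v" by (intro mult_right_mono Finite_Cartesian_Product.norm_nth_le) auto
    finally show "\<bar>(A *v v) $ i\<bar> \<le> norm A * norm v" .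
  qed
  finally show ?thesis by (simp add: mult_ac)
qed

text \<open>The Lipschitz constant of \<open>B x *v v\<close> in \<open>x\<close> is proportional to
  the size of \<open>v\<close>. Near \<open>(x0, v0)\<close> that size is at most \<open>R\<close>,
  while the bound \<open>b\<close> on \<open>B\<close> handles the dependence on
  \<open>v\<close>.\<close>

lemma locally_lipschitz_on_control_affine:
  fixes g :: "real ^ 'n \<Rightarrow> real ^ 'n" and B :: "real ^ 'n \<Rightarrow> real ^ 'm ^ 'n"
  assumes g: "locally_lipschitz_on X g" and B: "locally_lipschitz_on X B" and bdd: "bounded (B ` X)"
  shows "locally_lipschitz_on (X \<times> UNIV) (\<lambda>(x, v). c *\<^sub>R g x + B x *v v)"
  unfolding locally_lipschitz_on_def
proof (rule local_lipschitzI, clarify)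
  fix t :: real and x0 :: "real ^ 'n" and v0 :: "real ^ 'm" assume "x0 \<in> X"
  obtain r1 L1 where 1: "r1 > 0" "\<And>s::real. s \<in> cball 0 r1 \<inter> UNIV \<Longrightarrow> L1-lipschitz_on (cball x0 r1 \<inter> X) g"
    using local_lipschitzE[OF g[unfolded locally_lipschitz_on_def], of 0 x0] \<open>x0 \<in> X\<close> by blast
  obtain r2 L2 where 2: "r2 > 0" "\<And>s::real. s \<in> cball 0 r2 \<inter> UNIV \<Longrightarrow> L2-lipschitz_on (cball x0 r2 \<inter> X) B"
    using local_lipschitzE[OF B[unfolded locally_lipschitz_on_def], of 0 x0] \<open>x0 \<in> X\<close> by blast
  define r where "r = min r1 r2"
  have r: "r > 0" "r \<le> r1" "r \<le> r2" using 1 2 by (auto simp: r_def)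
  have L1: "L1-lipschitz_on (cball x0 r \<inter> X) g"
    using 1(2)[of 0] 1(1) r by (auto intro: lipschitz_on_subset)
  have L2: "L2-lipschitz_on (cball x0 r \<inter> X) B"
    using 2(2)[of 0] 2(1) r by (auto intro: lipschitz_on_subset)
  obtain b where b: "b > 0" "\<And>x. x \<in> X \<Longrightarrow> norm (B x) \<le> b"
    using bdd by (auto simp: bounded_pos)
  define R where "R = norm v0 + r"
  define k where "k = real CARD('n)"
  have k: "k \<ge> 0" by (simp add: k_def)
  have nn: "L1 \<ge> 0" "L2 \<ge> 0" "R \<ge> 0" using L1 L2 r(1) by (auto simp: lipschitz_on_def R_def)
  define K where "K = \<bar>c\<bar> * L1 + k * L2 * R + k * b"
  have "K-lipschitz_on (cball (x0, v0) r \<inter> X \<times> UNIV) (\<lambda>(x, v). c *\<^sub>R g x + B x *v v)"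
  proof (rule lipschitz_onI, clarify)
    fix x y and v w :: "real ^ 'm"
    assume xv: "(x, v) \<in> cball (x0, v0) r" "x \<in> X" and yw: "(y, w) \<in> cball (x0, v0) r" "y \<in> X"
    define \<delta> where "\<delta> = dist (x, v) (y, w)"
    have \<delta>: "\<delta> \<ge> 0" by (simp add: \<delta>_def)
    have x: "x \<in> cball x0 r \<inter> X" and y: "y \<in> cball x0 r \<inter> X"
      using xv yw dist_fst_le[of "(x0, v0)" "(x, v)"] dist_fst_le[of "(x0, v0)" "(y, w)"] by auto
    have "dist v0 v \<le> r"
      using xv dist_snd_le[of "(x0, v0)" "(x, v)"] by auto
    then have v: "norm v \<le> R"
      unfolding R_def using norm_triangle_ineq2[of v v0] by (simp add: dist_norm norm_minus_commute)
    have xy: "norm (x - y) \<le> \<delta>" "norm (v - w) \<le> \<delta>"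
      using dist_fst_le[of "(x, v)" "(y, w)"] dist_snd_le[of "(x, v)" "(y, w)"] by (auto simp: \<delta>_def dist_norm)
    have g: "norm (g x - g y) \<le> L1 * \<delta>"
      using lipschitz_on_normD[OF L1 x y] mult_left_mono[OF xy(1) nn(1)] by linarith
    have B: "norm (B x - B y) \<le> L2 * \<delta>"
      using lipschitz_on_normD[OF L2 x y] mult_left_mono[OF xy(1) nn(2)] by linarith
    have "(c *\<^sub>R g x + B x *v v) - (c *\<^sub>R g y + B y *v w) =
        c *\<^sub>R (g x - g y) + ((B x - B y) *v v + B y *v (v - w))"
      by (simp add: algebra_simps)
    also have "norm \<dots> \<le> norm (c *\<^sub>R (g x - g y)) + (norm ((B x - B y) *v v) + norm (B y *v (v - w)))"
      by (meson add_left_mono norm_triangle_ineq order.trans)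
    also have "\<dots> \<le> \<bar>c\<bar> * (L1 * \<delta>) + (k * (L2 * \<delta>) * R + k * b * \<delta>)"
    proof (intro add_mono)
      show "norm (c *\<^sub>R (g x - g y)) \<le> \<bar>c\<bar> * (L1 * \<delta>)"
        using mult_left_mono[OF g, of "\<bar>c\<bar>"] by simp
      have "norm ((B x - B y) *v v) \<le> k * norm (B x - B y) * norm v"
        unfolding k_def by (rule norm_matrix_vector_mult_le)
      also have "\<dots> \<le> k * (L2 * \<delta>) * R"
        using k B v nn \<delta> by (intro mult_mono) auto
      finally show "norm ((B x - B y) *v v) \<le> k * (L2 * \<delta>) * R" .
      have "norm (B y *v (v - w)) \<le> k * norm (B y) * norm (v - w)"
        unfolding k_def by (rule norm_matrix_vector_mult_le)
      also have "\<dots> \<le> k * b * \<delta>"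
        using k b yw(2) xy(2) by (intro mult_mono) auto
      finally show "norm (B y *v (v - w)) \<le> k * b * \<delta>" .
    qed
    also have "\<dots> = K * \<delta>" by (simp add: K_def algebra_simps)
    finally show "dist (c *\<^sub>R g x + B x *v v) (c *\<^sub>R g y + B y *v w) \<le> K * dist (x, v) (y, w)"
      by (simp add: dist_norm \<delta>_def)
  qed (use k nn b in \<open>auto simp: K_def\<close>)
  then show "\<exists>u>0. \<exists>L. \<forall>t\<in>cball t u \<inter> UNIV. L-lipschitz_on (cball (x0, v0) u \<inter> X \<times> UNIV) (\<lambda>(x, v). c *\<^sub>R g x + B x *v v)"
    using r(1) by blast
qed

section \<open>Decay of the loss, confinement and global existence\<close>

text \<open>The scaling factor \<open>c\<close> admits the cut-off field, for which
  \<open>c0 = 0\<close> still yields that the loss at \<open>t\<close> is at most its initial value,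
  alongside the original field, for which \<open>c0 = 1\<close> yields the decay rate.\<close>

lemma lyapunov_decay_along_trajectory:
  fixes V :: "'a::euclidean_space \<Rightarrow> real"
  assumes V: "proper_loss_function X xbar V" and "open X" and "\<eta> > 0" and "c0 \<ge> 0"
    and \<rho>: "\<rho> \<in> class_K_inf" "\<And>x. x \<in> X \<Longrightarrow> \<rho> (V x - V xbar) \<le> norm (gradient V x)"
    and L: "L \<ge> 0" "2 * k \<le> \<eta> * \<rho> L"
    and "t \<ge> 0" and ac: "abs_continuous_on {0..t} x" and X: "\<And>\<tau>. 0 \<le> \<tau> \<Longrightarrow> \<tau> \<le> t \<Longrightarrow> x \<tau> \<in> X"
    and ae: "AE \<tau> in lebesgue. 0 < \<tau> \<and> \<tau> < t \<longrightarrow> (\<exists>c w. c0 \<le> c \<and> norm w \<le> k \<and>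
      (x has_vector_derivative c *\<^sub>R (- \<eta> *\<^sub>R gradient V (x \<tau>) + w)) (at \<tau>))"
    and above: "L < V (x t) - V xbar"
  shows "V (x t) - V xbar + t * (c0 * (\<eta> / 2 * (\<rho> (V (x t) - V xbar))\<^sup>2)) \<le> V (x 0) - V xbar"
proof -
  define y where "y \<tau> = V (x \<tau>) - V xbar" for \<tau>
  define \<psi> where "\<psi> a = c0 * (\<eta> / 2 * (\<rho> a)\<^sup>2)" for a
  note K = class_KD[OF class_K_inf_imp_class_K[OF \<rho>(1)]]
  have diff: "V differentiable (at x)" if "x \<in> X" for x
    using V that by (auto simp: proper_loss_function_def)
  have cont: "continuous_on X (gradient V)" using V by (auto simp: proper_loss_function_def)
  have "locally_lipschitz_on X V"
    by (rule continuous_gradient_imp_locally_lipschitz_on[OF \<open>open X\<close> diff cont])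
  moreover have "compact (x ` {0..t})"
    by (intro compact_continuous_image abs_continuous_on_imp_continuous_on[OF ac] compact_Icc)
  moreover have "x ` {0..t} \<subseteq> X" using X by auto
  ultimately obtain M where M: "M-lipschitz_on (x ` {0..t}) V"
    by (rule locally_lipschitz_on_imp_lipschitz_on_compact)
  have "M-lipschitz_on (x ` {0..t}) (\<lambda>z. V z - V xbar)"
    using M by (simp add: lipschitz_on_def dist_norm)
  then have "abs_continuous_on {0..t} y"
    unfolding y_def by (rule abs_continuous_on_compose_lipschitz[OF ac])
  moreover have "AE \<tau> in lebesgue. 0 < \<tau> \<and> \<tau> < t \<longrightarrow> L < y \<tau> \<longrightarrow>
      (\<exists>D\<le>- \<psi> (y \<tau>). (y has_real_derivative D) (at \<tau>))"
    using ae
  proof eventually_elim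
    case (elim \<tau>)
    show ?case
    proof (intro impI)
      assume \<tau>: "0 < \<tau> \<and> \<tau> < t" and Ly: "L < y \<tau>"
      then obtain c w where c: "c0 \<le> c" and w: "norm w \<le> k"
        and x': "(x has_vector_derivative c *\<^sub>R (- \<eta> *\<^sub>R gradient V (x \<tau>) + w)) (at \<tau>)"
        using elim by blast
      have xX: "x \<tau> \<in> X" using X \<tau> by simp
      define g where "g = gradient V (x \<tau>)"
      define D where "D = (c *\<^sub>R (- \<eta> *\<^sub>R g + w)) \<bullet> g"
      have "(V has_derivative (\<lambda>h. h \<bullet> g)) (at (x \<tau>))"
        using GDERIV_gradient[OF diff[OF xX]] by (simp add: gderiv_def g_def)
      from has_derivative_compose[OF x'[unfolded has_vector_derivative_def] this]
      have "((\<lambda>\<tau>. V (x \<tau>)) has_real_derivative D) (at \<tau>)"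
        unfolding has_field_derivative_def
        by (rule has_derivative_eq_rhs) (simp add: fun_eq_iff D_def g_def)
      then have "(y has_real_derivative D) (at \<tau>)"
        unfolding y_def by (auto intro!: derivative_eq_intros)
      moreover have "D \<le> - \<psi> (y \<tau>)"
      proof -
        have \<rho>y: "0 \<le> \<rho> (y \<tau>)" "\<rho> (y \<tau>) \<le> norm g"
          using \<rho>(2)[OF xX] K(3)[of "y \<tau>"] L(1) Ly by (auto simp: y_def g_def)
        have "\<rho> L \<le> \<rho> (y \<tau>)" using L(1) Ly by (intro K(6)) auto
        then have "\<rho> L \<le> norm g" using \<rho>y by simp
        then have "\<eta> * \<rho> L \<le> \<eta> * norm g" using \<open>\<eta> > 0\<close> by simp
        \<comment> \<open>The choice of \<open>L\<close> limits the perturbation to half the size of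
          the gradient term, so half of the dissipation survives.\<close>
        then have "norm w \<le> \<eta> / 2 * norm g" using w L(2) by simp
        then have "norm w * norm g \<le> \<eta> / 2 * norm g * norm g" by (rule mult_right_mono) simp
        then have "w \<bullet> g \<le> \<eta> / 2 * (norm g)\<^sup>2"
          using norm_cauchy_schwarz[of w g] by (simp add: power2_eq_square)
        then have "- \<eta> * (norm g)\<^sup>2 + w \<bullet> g \<le> - (\<eta> / 2 * (norm g)\<^sup>2)" by (simp add: field_simps)
        also have "\<dots> \<le> - (\<eta> / 2 * (\<rho> (y \<tau>))\<^sup>2)"
          using \<rho>y \<open>\<eta> > 0\<close> by (simp add: power_mono)
        finally have le: "- \<eta> * (norm g)\<^sup>2 + w \<bullet> g \<le> - (\<eta> / 2 * (\<rho> (y \<tau>))\<^sup>2)" .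
        have "D = c * (- \<eta> * (norm g)\<^sup>2 + w \<bullet> g)"
          by (simp add: D_def inner_add_left inner_diff_left power2_norm_eq_inner)
        also have "\<dots> \<le> c * (- (\<eta> / 2 * (\<rho> (y \<tau>))\<^sup>2))"
          using le c \<open>c0 \<ge> 0\<close> by (intro mult_left_mono) auto
        \<comment> \<open>The bracket is nonpositive, so a larger \<open>c\<close> only improves the
          bound.\<close>
        also have "\<dots> \<le> c0 * (- (\<eta> / 2 * (\<rho> (y \<tau>))\<^sup>2))"
          using c \<open>\<eta> > 0\<close> by (intro mult_right_mono_neg) auto
        finally show ?thesis by (simp add: \<psi>_def)
      qed
      ultimately show "\<exists>D\<le>- \<psi> (y \<tau>). (y has_real_derivative D) (at \<tau>)" by blast
    qed
  qed
  moreover have "0 \<le> \<psi> a" if "L < a" for a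
    using \<open>c0 \<ge> 0\<close> \<open>\<eta> > 0\<close> by (simp add: \<psi>_def)
  moreover have "\<psi> a \<le> \<psi> b" if "L < a" "a \<le> b" for a b
    unfolding \<psi>_def using that \<open>c0 \<ge> 0\<close> \<open>\<eta> > 0\<close> L(1)
    by (intro mult_left_mono power_mono K) auto
  moreover have "L < y t" using above by (simp add: y_def)
  ultimately have "y t + t * \<psi> (y t) \<le> y 0"
    by (rule abs_continuous_decay[OF \<open>t \<ge> 0\<close>])
  then show ?thesis by (simp add: y_def \<psi>_def)
qed

text \<open>Here \<open>step\<close> may be used only while the path is known to lie in
  \<open>X\<close>. At the infimum \<open>T\<close> of the exit times the path is still in
  \<open>C\<close>, which is closed; by continuity it remains in the open \<open>X\<close> a little
  longer, and \<open>step\<close> applied to an exit time in that span contradicts the exit.\<close>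

lemma stays_in_closed:
  fixes z :: "real \<Rightarrow> 'a::metric_space"
  assumes "open X" "closed C" "C \<subseteq> X" and cont: "\<And>b. continuous_on {0..b} z" and "z 0 \<in> C"
    and step: "\<And>t. 0 \<le> t \<Longrightarrow> (\<And>s. 0 \<le> s \<Longrightarrow> s \<le> t \<Longrightarrow> z s \<in> X) \<Longrightarrow> z t \<in> C"
    and "t \<ge> 0"
  shows "z t \<in> C"
proof (rule ccontr)
  assume "z t \<notin> C"
  define S where "S = {s. 0 \<le> s \<and> z s \<notin> C}"
  have "t \<in> S" using \<open>z t \<notin> C\<close> \<open>t \<ge> 0\<close> by (simp add: S_def)
  have bdd: "bdd_below S" by (rule bdd_belowI[of _ 0]) (simp add: S_def)
  define T where "T = Inf S"
  have T0: "0 \<le> T" unfolding T_def using \<open>t \<in> S\<close> by (intro cInf_greatest) (auto simp: S_def)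
  have before: "z s \<in> C" if "0 \<le> s" "s < T" for s
    using that cInf_lower[OF _ bdd, of s] by (auto simp: T_def S_def)
  have loc: "\<exists>d>0. \<forall>s. 0 \<le> s \<longrightarrow> \<bar>s - T\<bar> < d \<longrightarrow> z s \<in> A" if A: "open A" "z T \<in> A" for A
  proof -
    obtain e where e: "e > 0" "ball (z T) e \<subseteq> A" by (rule openE[OF A])
    obtain d where d: "d > 0" "\<And>s. s \<in> {0..T + 1} \<Longrightarrow> dist s T < d \<Longrightarrow> dist (z s) (z T) < e"
      using cont[of "T + 1"] T0 e(1) unfolding continuous_on_iff by fastforce
    show ?thesis
    proof (intro exI[of _ "min d 1"] conjI allI impI)
      fix s assume "0 \<le> s" "\<bar>s - T\<bar> < min d 1"
      then have "dist (z s) (z T) < e" by (intro d(2)) (auto simp: dist_real_def abs_if split: if_splits)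
      then show "z s \<in> A" using e(2) by (auto simp: dist_commute)
    qed (use d(1) in simp)
  qed
  have "z T \<in> C"
  proof (rule ccontr)
    assume "z T \<notin> C"
    then obtain d where d: "d > 0" "\<forall>s. 0 \<le> s \<longrightarrow> \<bar>s - T\<bar> < d \<longrightarrow> z s \<in> - C"
      using loc[of "- C"] \<open>closed C\<close> by auto
    have "T > 0" using \<open>z T \<notin> C\<close> \<open>z 0 \<in> C\<close> T0 by (cases "T = 0") auto
    define s where "s = max 0 (T - d / 2)"
    have "0 \<le> s" "s < T" "\<bar>s - T\<bar> < d" using \<open>T > 0\<close> d(1) by (auto simp: s_def)
    then show False using d(2) before by auto
  qed
  then obtain d where d: "d > 0" "\<forall>s. 0 \<le> s \<longrightarrow> \<bar>s - T\<bar> < d \<longrightarrow> z s \<in> X"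
    using loc[OF \<open>open X\<close>] \<open>C \<subseteq> X\<close> by auto
  obtain r where r: "r \<in> S" "r < T + d"
    using cInf_lessD[of S "T + d"] \<open>t \<in> S\<close> d(1) by (auto simp: T_def)
  have "z s \<in> X" if "0 \<le> s" "s \<le> r" for s
  proof (cases "s < T")
    case True
    then show ?thesis using before that \<open>C \<subseteq> X\<close> by auto
  next
    case False
    then show ?thesis using d(2) that r(2) by auto
  qed
  then have "z r \<in> C" using r(1) by (intro step) (auto simp: S_def)
  then show False using r(1) by (simp add: S_def)
qed

text \<open>The existence result wants an input that is measurable on the whole line and bounded at
  every time. Setting \<open>u\<close> to 0 at negative times and where the bound fails does not
  affect an equation that holds almost everywhere for positive time.\<close>

lemma is_input_bounded_representative:
  fixes u :: "real \<Rightarrow> 'b::euclidean_space"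
  assumes "is_input u"
  obtains u' where "u' \<in> borel_measurable lebesgue" "\<And>t. norm (u' t) \<le> input_norm u"
    "AE t in lebesgue. 0 \<le> t \<longrightarrow> u' t = u t"
proof
  define u' where "u' t = (if 0 \<le> t \<and> norm (u t) \<le> input_norm u then u t else 0)" for t
  have "u \<in> borel_measurable (lebesgue_on {0..})" using assms by (simp add: is_input_def)
  then have w: "(\<lambda>t. indicat_real {0..} t *\<^sub>R u t) \<in> borel_measurable lebesgue" (is "?w \<in> _")
    by (subst (asm) borel_measurable_restrict_space_iff) auto
  have "(\<lambda>t. if norm (?w t) \<le> input_norm u then ?w t else 0) \<in> borel_measurable lebesgue"
    using w by measurable
  moreover have "(\<lambda>t. if norm (?w t) \<le> input_norm u then ?w t else 0) = u'"
    by (auto simp: u'_def fun_eq_iff indicator_def)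
  ultimately show "u' \<in> borel_measurable lebesgue" by simp
  show "norm (u' t) \<le> input_norm u" for t
    using input_norm_bound(2)[OF assms] by (simp add: u'_def)
  show "AE t in lebesgue. 0 \<le> t \<longrightarrow> u' t = u t"
    using input_norm_bound(1)[OF assms] by eventually_elim (simp add: u'_def)
qed

text \<open>The cut-off field is a nonnegative multiple of the original one, so the loss still decreases
  along it above the level \<open>L\<close>; hence its solution never leaves the region where the cut-off is
  trivial, and solves the original system.\<close>

lemma global_solution_exists:
  fixes V :: "'a::euclidean_space \<Rightarrow> real" and f :: "'a \<Rightarrow> 'b::euclidean_space \<Rightarrow> 'a"
  assumes V: "proper_loss_function X xbar V" and "open X" and "\<eta> > 0"
    and \<rho>: "\<rho> \<in> class_K_inf" "\<And>x. x \<in> X \<Longrightarrow> \<rho> (V x - V xbar) \<le> norm (gradient V x)"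
    and L: "L \<ge> 0" "2 * k \<le> \<eta> * \<rho> L"
    and lip: "locally_lipschitz_on (X \<times> UNIV) (\<lambda>(x, v). f x v)"
    and f: "\<And>x v. x \<in> X \<Longrightarrow> norm v \<le> input_norm u \<Longrightarrow> norm (f x v + \<eta> *\<^sub>R gradient V x) \<le> k"
    and u: "is_input u" and "x0 \<in> X"
  shows "\<exists>z. is_solution X f x0 u \<infinity> z"
proof -
  define W where "W x = V x - V xbar" for x
  \<comment> \<open>The maximum puts \<open>x0\<close> into \<open>C\<close>, and makes any point of
    \<open>X\<close> outside \<open>C\<close> lie both above \<open>L\<close>, where the loss
    decreases, and above the initial value.\<close>
  define C where "C = {x \<in> X. W x \<le> max L (W x0)}"
  have "compact C"
    using V L(1) by (auto simp: C_def W_def proper_loss_function_def size_function_def)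
  have C: "C \<subseteq> X" "x0 \<in> C" using \<open>x0 \<in> X\<close> by (auto simp: C_def)
  obtain u' where u': "u' \<in> borel_measurable lebesgue" "\<And>t. norm (u' t) \<le> input_norm u"
      "AE t in lebesgue. 0 \<le> t \<longrightarrow> u' t = u t"
    using is_input_bounded_representative[OF u] by blast
  obtain \<zeta> K M where \<zeta>: "\<And>x. 0 \<le> \<zeta> x" "\<And>x. \<zeta> x \<le> 1" "\<And>x. x \<in> C \<Longrightarrow> \<zeta> x = 1"
    and K: "K-lipschitz_on (UNIV \<times> cball 0 (input_norm u)) (\<lambda>(x, v). \<zeta> x *\<^sub>R f x v)"
    and M: "\<And>x v. norm v \<le> input_norm u \<Longrightarrow> norm (\<zeta> x *\<^sub>R f x v) \<le> M"
    using cutoff_lipschitz[OF lip \<open>open X\<close> \<open>compact C\<close> _ C(1) input_norm_bound(2)[OF u]] C(2) by blast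
  obtain z where z0: "z 0 = x0" and ac: "\<And>b. abs_continuous_on {0..b} z"
    and z': "AE t in lebesgue. 0 < t \<longrightarrow> (z has_vector_derivative \<zeta> (z t) *\<^sub>R f (z t) (u' t)) (at t)"
    using caratheodory_global_solution[where H = "\<lambda>x v. \<zeta> x *\<^sub>R f x v", OF K M u'(1) u'(2), of x0] by blast
  have inC: "z t \<in> C" if "t \<ge> 0" for t
  proof (rule stays_in_closed[OF \<open>open X\<close> compact_imp_closed[OF \<open>compact C\<close>] C(1) _ _ _ that])
    show "continuous_on {0..b} z" for b by (rule abs_continuous_on_imp_continuous_on[OF ac])
    show "z 0 \<in> C" using C(2) z0 by simp
    fix t :: real assume t: "0 \<le> t" and zX: "\<And>s. 0 \<le> s \<Longrightarrow> s \<le> t \<Longrightarrow> z s \<in> X"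
    show "z t \<in> C"
    proof (rule ccontr)
      assume "z t \<notin> C"
      then have above: "L < W (z t)" "W x0 < W (z t)" using zX[of t] t by (auto simp: C_def)
      \<comment> \<open>The cut-off may vanish, so no positive lower bound for the scaling is
        available. With \<open>c0 = 0\<close> the estimate says \<open>W (z t) \<le> W x0\<close>,
        which contradicts \<open>above\<close>.\<close>
      have "V (z t) - V xbar + t * (0 * (\<eta> / 2 * (\<rho> (V (z t) - V xbar))\<^sup>2)) \<le> V (z 0) - V xbar"
      proof (rule lyapunov_decay_along_trajectory[OF V \<open>open X\<close> \<open>\<eta> > 0\<close> order.refl \<rho> L t ac zX])
        show "AE \<tau> in lebesgue. 0 < \<tau> \<and> \<tau> < t \<longrightarrow> (\<exists>c w. 0 \<le> c \<and> norm w \<le> k \<and>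
            (z has_vector_derivative c *\<^sub>R (- \<eta> *\<^sub>R gradient V (z \<tau>) + w)) (at \<tau>))"
          using z'
        proof eventually_elim
          case (elim \<tau>)
          show ?case
          proof
            assume \<tau>: "0 < \<tau> \<and> \<tau> < t"
            then have "norm (f (z \<tau>) (u' \<tau>) + \<eta> *\<^sub>R gradient V (z \<tau>)) \<le> k"
              by (intro f zX u'(2)) auto
            with elim \<tau> \<zeta>(1) show "\<exists>c w. 0 \<le> c \<and> norm w \<le> k \<and>
                (z has_vector_derivative c *\<^sub>R (- \<eta> *\<^sub>R gradient V (z \<tau>) + w)) (at \<tau>)"
              by (intro exI[of _ "\<zeta> (z \<tau>)"] exI[of _ "f (z \<tau>) (u' \<tau>) + \<eta> *\<^sub>R gradient V (z \<tau>)"]) auto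
          qed
        qed
      qed (use above in \<open>auto simp: W_def\<close>)
      then show False using above(2) z0 by (simp add: W_def)
    qed
  qed
  have "AE t in lebesgue. 0 < t \<longrightarrow> (z has_vector_derivative f (z t) (u t)) (at t)"
    using z' u'(3)
  proof eventually_elim
    case (elim t)
    then show ?case using inC[of t] \<zeta>(3) by auto
  qed
  then have "is_solution X f x0 u \<infinity> z"
    unfolding is_solution_def using z0 inC C(1) ac by auto
  then show ?thesis by blast
qed

section \<open>Assembly of the KL bound and the gain\<close>

theorem theorem2:
  fixes X :: "(real ^ 'n) set" and xbar :: "real ^ 'n" and \<omega> V :: "real ^ 'n \<Rightarrow> real"
    and \<eta> :: real and B :: "real ^ 'n \<Rightarrow> real ^ 'm ^ 'n"
  assumes "open X" and "xbar \<in> X"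
    and "size_function X xbar \<omega>"
    and "\<eta> > 0"
    and "locally_lipschitz_on X B" and "bounded (B ` X)"
    and "proper_loss_function X xbar V"
  shows "ISS X xbar \<omega> (\<lambda>x v. - \<eta> *\<^sub>R gradient V x + B x *v v)"
proof -
  define f where "f = (\<lambda>x v. - \<eta> *\<^sub>R gradient V x + B x *v v)"
  define W where "W x = V x - V xbar" for x
  note \<omega> = \<open>size_function X xbar \<omega>\<close> and V = \<open>proper_loss_function X xbar V\<close>
  have W: "size_function X xbar W"
    and g: "size_function X xbar (\<lambda>x. norm (gradient V x))"
    and glip: "locally_lipschitz_on X (gradient V)"
    using V unfolding proper_loss_function_def W_def by auto

  have lip: "locally_lipschitz_on (X \<times> UNIV) (\<lambda>(x, v). f x v)"
    unfolding f_def
    by (rule locally_lipschitz_on_control_affine[OF glip \<open>locally_lipschitz_on X B\<close> \<open>bounded (B ` X)\<close>])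
  have "gradient V xbar = 0" using g by (simp add: size_function_def)
  then have cs: "control_system X xbar f"
    using lip by (simp add: control_system_def f_def)

  obtain b0 where b0: "b0 > 0" "\<And>x. x \<in> X \<Longrightarrow> norm (B x) \<le> b0"
    using \<open>bounded (B ` X)\<close> by (auto simp: bounded_pos)
  define b where "b = real CARD('n) * b0"
  have "b > 0" using b0(1) by (simp add: b_def)
  have b: "norm (B x *v v) \<le> b * norm v" if "x \<in> X" for x v
  proof -
    have "norm (B x *v v) \<le> real CARD('n) * norm (B x) * norm v" by (rule norm_matrix_vector_mult_le)
    also have "\<dots> \<le> b * norm v"
      unfolding b_def using b0(2)[OF that] by (intro mult_right_mono mult_left_mono) auto
    finally show ?thesis .
  qed

  \<comment> \<open>Comparison of size functions bounds \<open>W\<close> by a function of the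
    gradient norm; its inverse \<open>\<rho>\<close> turns this into the required lower bound for
    the gradient norm.\<close>
  obtain \<phi> where \<phi>: "\<phi> \<in> class_K_inf" "\<And>x. x \<in> X \<Longrightarrow> W x \<le> \<phi> (norm (gradient V x))"
    by (rule size_function_comparison[OF W g \<open>xbar \<in> X\<close>]) blast
  obtain \<rho> where \<rho>: "\<rho> \<in> class_K_inf" "\<And>s. s \<ge> 0 \<Longrightarrow> \<rho> (\<phi> s) = s"
    by (rule class_K_inf_inverse[OF \<phi>(1)]) blast
  note \<rho>K = class_KD[OF class_K_inf_imp_class_K[OF \<rho>(1)]]
  have \<rho>g: "\<rho> (V x - V xbar) \<le> norm (gradient V x)" if "x \<in> X" for x
  proof -
    have "\<rho> (W x) \<le> \<rho> (\<phi> (norm (gradient V x)))"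
      using size_function_nonneg[OF W that] \<phi>(2)[OF that] by (rule \<rho>K(6))
    then show ?thesis by (simp add: \<rho>(2) W_def)
  qed
  obtain \<kappa>1 where \<kappa>1: "\<kappa>1 \<in> class_K_inf" "\<And>x. x \<in> X \<Longrightarrow> \<omega> x \<le> \<kappa>1 (W x)"
    by (rule size_function_comparison[OF \<omega> W \<open>xbar \<in> X\<close>]) blast
  obtain \<kappa>2 where \<kappa>2: "\<kappa>2 \<in> class_K_inf" "\<And>x. x \<in> X \<Longrightarrow> W x \<le> \<kappa>2 (\<omega> x)"
    by (rule size_function_comparison[OF W \<omega> \<open>xbar \<in> X\<close>]) blast
  note \<kappa>1K = class_KD[OF class_K_inf_imp_class_K[OF \<kappa>1(1)]]
  note \<kappa>2K = class_KD[OF class_K_inf_imp_class_K[OF \<kappa>2(1)]]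

  define \<psi> where "\<psi> s = \<eta> / 2 * (\<rho> s)\<^sup>2" for s
  have "\<psi> \<in> class_K"
  proof (rule class_KI)
    show "continuous_on {0..} \<psi>" unfolding \<psi>_def by (intro continuous_intros \<rho>K)
    show "strict_mono_on {0..} \<psi>"
      unfolding \<psi>_def using \<open>\<eta> > 0\<close>
      by (intro strict_mono_onI mult_strict_left_mono power_strict_mono \<rho>K) auto
  qed (simp add: \<psi>_def \<rho>K)
  then obtain \<beta> where \<beta>: "\<beta> \<in> class_KL" "\<And>r s t. 0 \<le> s \<Longrightarrow> 0 \<le> t \<Longrightarrow> s + t * \<psi> s \<le> r \<Longrightarrow> s \<le> \<beta> r t"
    by (rule class_KL_of_decay) blast
  have \<beta>K: "(\<lambda>r. \<beta> r t) \<in> class_K" if "t \<ge> 0" for t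
    using \<beta>(1) that by (auto simp: class_KL_def)
  \<comment> \<open>The decay is proved for \<open>W\<close>: \<open>\<kappa>2\<close> converts the
    initial value of \<open>\<omega>\<close> into one of \<open>W\<close>, and
    \<open>\<kappa>1\<close> converts the bound back.\<close>
  define \<beta>' where "\<beta>' r t = \<kappa>1 (\<beta> (\<kappa>2 r) t)" for r t
  \<comment> \<open>This is the level \<open>L\<close> solved for explicitly: as
    \<open>\<rho>\<close> inverts \<open>\<phi>\<close>,
    \<open>\<rho> (\<Lambda> U) = 2 * b * U / \<eta>\<close>.\<close>
  define \<Lambda> where "\<Lambda> U = \<phi> (2 * b / \<eta> * U)" for U
  define \<gamma> where "\<gamma> U = \<kappa>1 (\<Lambda> U)" for U
  have \<beta>': "\<beta>' \<in> class_KL"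
    unfolding \<beta>'_def
    by (rule class_KL_compose[OF \<beta>(1) class_K_inf_imp_class_K[OF \<kappa>1(1)] class_K_inf_imp_class_K[OF \<kappa>2(1)]])
  have \<Lambda>: "\<Lambda> \<in> class_K_inf"
    unfolding \<Lambda>_def using \<open>b > 0\<close> \<open>\<eta> > 0\<close>
    by (intro class_K_inf_compose[OF \<phi>(1) class_K_inf_linear]) auto
  have \<gamma>: "\<gamma> \<in> class_K_inf"
    unfolding \<gamma>_def by (rule class_K_inf_compose[OF \<kappa>1(1) \<Lambda>])

  show ?thesis
    unfolding f_def[symmetric] ISS_def
  proof (intro conjI cs bexI[OF _ \<beta>'] bexI[OF _ \<gamma>] allI impI ballI)
    fix u :: "real \<Rightarrow> real ^ 'm" and x0 assume u: "is_input u" and "x0 \<in> X"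
    define U where "U = input_norm u"
    have U: "U \<ge> 0" using input_norm_bound(2)[OF u] by (simp add: U_def)
    have L: "\<Lambda> U \<ge> 0" by (rule class_KD(3)[OF class_K_inf_imp_class_K[OF \<Lambda>] U])
    have "\<rho> (\<Lambda> U) = 2 * b / \<eta> * U"
      unfolding \<Lambda>_def using \<open>b > 0\<close> \<open>\<eta> > 0\<close> U by (intro \<rho>(2)) auto
    then have k: "2 * (b * U) \<le> \<eta> * \<rho> (\<Lambda> U)" using \<open>\<eta> > 0\<close> by simp
    have pert: "norm (B x *v v) \<le> b * U" if "x \<in> X" "norm v \<le> U" for x v
      using order.trans[OF b[OF that(1), of v] mult_left_mono[OF that(2), of b]] \<open>b > 0\<close> by simp

    have "\<exists>z. is_solution X f x0 u \<infinity> z"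
    proof (rule global_solution_exists[OF V \<open>open X\<close> \<open>\<eta> > 0\<close> \<rho>(1) \<rho>g L k lip _ u \<open>x0 \<in> X\<close>])
      show "norm (f x v + \<eta> *\<^sub>R gradient V x) \<le> b * U" if "x \<in> X" "norm v \<le> input_norm u" for x v
        using pert[of x v] that by (simp add: f_def U_def)
    qed
    then have "\<infinity> \<le> t_max X f x0 u"
      unfolding t_max_def by (intro Sup_upper) auto
    then show "t_max X f x0 u = \<infinity>" by simp

    fix T x t assume sol: "is_solution X f x0 u T x" and t: "0 \<le> t" "ereal t < T"
    have xX: "x s \<in> X" if "0 \<le> s" "s \<le> t" for s
    proof -
      have "ereal s < T" using that t by (meson ereal_less_eq(3) order.strict_trans1)
      then show ?thesis using sol that by (auto simp: is_solution_def)
    qed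
    have ac: "abs_continuous_on {0..t} x" and x0: "x 0 = x0"
      and x': "AE t in lebesgue. 0 < t \<and> ereal t < T \<longrightarrow> (x has_vector_derivative f (x t) (u t)) (at t)"
      using sol t by (auto simp: is_solution_def)
    have \<omega>x: "\<omega> (x t) \<le> \<kappa>1 (W (x t))" and W0: "W (x t) \<ge> 0" and "\<omega> x0 \<ge> 0"
      using \<kappa>1(2) xX[of t] t size_function_nonneg[OF W] size_function_nonneg[OF \<omega> \<open>x0 \<in> X\<close>] by auto
    have \<beta>0: "\<beta> (\<kappa>2 (\<omega> x0)) t \<ge> 0"
      using class_KD(3)[OF \<beta>K[OF t(1)] \<kappa>2K(3)[OF \<open>\<omega> x0 \<ge> 0\<close>]] .
    show "\<omega> (x t) \<le> \<beta>' (\<omega> x0) t + \<gamma> (input_norm u)"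
    \<comment> \<open>The argument gives a maximum rather than a sum: up to the level
      \<open>\<Lambda> U\<close> the gain alone suffices, above it the KL term alone, and the other
      summand is nonnegative.\<close>
    proof (cases "W (x t) \<le> \<Lambda> U")
      case True
      have "\<omega> (x t) \<le> \<gamma> U" unfolding \<gamma>_def using \<omega>x \<kappa>1K(6)[OF W0 True] by simp
      moreover have "0 \<le> \<beta>' (\<omega> x0) t" unfolding \<beta>'_def using \<beta>0 by (rule \<kappa>1K(3))
      ultimately show ?thesis by (simp add: U_def)
    next
      case False
      have "V (x t) - V xbar + t * (1 * (\<eta> / 2 * (\<rho> (V (x t) - V xbar))\<^sup>2)) \<le> V (x 0) - V xbar"
      proof (rule lyapunov_decay_along_trajectory[OF V \<open>open X\<close> \<open>\<eta> > 0\<close> zero_le_one \<rho>(1) \<rho>g L k t(1) ac xX])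
        show "AE \<tau> in lebesgue. 0 < \<tau> \<and> \<tau> < t \<longrightarrow> (\<exists>c w. 1 \<le> c \<and> norm w \<le> b * U \<and>
            (x has_vector_derivative c *\<^sub>R (- \<eta> *\<^sub>R gradient V (x \<tau>) + w)) (at \<tau>))"
          using x' input_norm_bound(1)[OF u]
        proof eventually_elim
          case (elim \<tau>)
          show ?case
          proof
            assume \<tau>: "0 < \<tau> \<and> \<tau> < t"
            then have "ereal \<tau> < T" using t(2) by (meson ereal_less(2) less_ereal.simps(1) order.strict_trans)
            then have "(x has_vector_derivative f (x \<tau>) (u \<tau>)) (at \<tau>)" using elim \<tau> by blast
            moreover have "norm (B (x \<tau>) *v u \<tau>) \<le> b * U"
              using elim \<tau> xX[of \<tau>] by (intro pert) (auto simp: U_def)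
            ultimately show "\<exists>c w. 1 \<le> c \<and> norm w \<le> b * U \<and>
                (x has_vector_derivative c *\<^sub>R (- \<eta> *\<^sub>R gradient V (x \<tau>) + w)) (at \<tau>)"
              by (intro exI[of _ 1] exI[of _ "B (x \<tau>) *v u \<tau>"]) (simp add: f_def)
          qed
        qed
      qed (use False in \<open>auto simp: W_def\<close>)
      then have "W (x t) + t * \<psi> (W (x t)) \<le> W x0" by (simp add: W_def \<psi>_def x0)
      also have "W x0 \<le> \<kappa>2 (\<omega> x0)" by (rule \<kappa>2(2)) fact
      finally have "W (x t) \<le> \<beta> (\<kappa>2 (\<omega> x0)) t" by (rule \<beta>(2)[OF W0 t(1)])
      then have "\<omega> (x t) \<le> \<beta>' (\<omega> x0) t"
        unfolding \<beta>'_def using \<omega>x \<kappa>1K(6)[OF W0] by fastforce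
      moreover have "0 \<le> \<gamma> U" by (rule class_KD(3)[OF class_K_inf_imp_class_K[OF \<gamma>] U])
      ultimately show ?thesis by (simp add: U_def)
    qed
  qed
qed

end
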